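(* Let $m,n\ge 1$, let $\Phi:\mathbb R^n\to[0,\infty)$ and let $A_1(t),\dots,A_m(t)$ be real $n\times n$ matrices that are invertible for almost every $t$ in the support of $\Phi$. Let $q_1(\cdot),\dots,q_m(\cdot)\in\mathcal P_b(\mathbb R^n)\cap\mathcal P_\infty(\mathbb R^n)$ and $q(\cdot)\in\mathcal P_\infty(\mathbb R^n)$, and let $\lambda,\alpha,\gamma,\alpha_i,\lambda_i,\gamma_i$ be real numbers with $\lambda_i\in(-\frac1{q_{i\infty}},0)$, $\gamma_i\in(-n,\infty)$, $i=1,\dots,m$, such that $$\frac1{q_1(\cdot)}+\cdots+\frac1{q_m(\cdot)}=\frac1{q(\cdot)},\qquad \frac{\gamma_1}{q_{1\infty}}+\cdots+\frac{\gamma_m}{q_{m\infty}}=\frac\gamma{q_\infty},$$ $$\frac{n+\gamma_1}{n+\gamma}\lambda_1+\cdots+\frac{n+\gamma_m}{n+\gamma}\lambda_m=\lambda,\qquad \alpha_1+\cdots+\alpha_m=\alpha.$$ Let $\omega_i(x)=|x|^{\gamma_i}$, $\omega(x)=|x|^\gamma$, $v_i(x)=|x|^{\alpha_i}$, $v(x)=|x|^\alpha$. Assume that for almost every $t\in\operatorname{supp}(\Phi)$ and all $i$, $$q_i(A_i^{-1}(t)\cdot)\le q_i(\cdot),\qquad \|1\|_{L^{r_{1i}(t,\cdot)}}<\infty,\qquad\text{where }\frac1{r_{1i}(t,\cdot)}=\frac1{q_i(A_i^{-1}(t)\cdot)}-\frac1{q_i(\cdot)},$$ and that $$\mathcal C_{10}=\int_{\mathbb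 R^n}\frac{\Phi(t)}{|t|^n}\prod_{i=1}^m\|A_i(t)\|^{(n+\gamma_i)\left(\frac1{q_{i\infty}}+\lambda_i\right)}c_{A_i,q_i,\alpha_i}(t)\|1\|_{L^{r_{1i}(t,\cdot)}}\,dt<+\infty,$$ where $$c_{A_i,q_i,\alpha_i}(t)=\max\{\|A_i(t)\|^{-\alpha_i},\|A_i^{-1}(t)\|^{\alpha_i}\}\,\max\{|\det A_i^{-1}(t)|^{1/q_{i+}},|\det A_i^{-1}(t)|^{1/q_{i-}}\}.$$ Then $H_{\Phi,\vec A}$ is bounded from $\dot B^{q_1(\cdot),\lambda_1}_{\omega_1,v_1}\times\cdots\times\dot B^{q_m(\cdot),\lambda_m}_{\omega_m,v_m}$ to $\dot B^{q(\cdot),\lambda}_{\omega,v}$.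
   Context: All functions and matrix-valued functions are Lebesgue measurable. The multilinear Hausdorff operator is $H_{\Phi,\vec A}(\vec f)(x)=\int_{\mathbb R^n}\frac{\Phi(t)}{|t|^n}\prod_{i=1}^m f_i(A_i(t)x)\,dt$, $x\in\mathbb R^n$, for $\vec f=(f_1,\dots,f_m)$ measurable functions $\mathbb R^n\to\mathbb C$, $\vec A=(A_1,\dots,A_m)$. Bounded means $\|H_{\Phi,\vec A}(\vec f)\|\le C\prod_i\|f_i\|$ with $C$ independent of $\vec f$. For a matrix $A=(a_{ij})$, $\|A\|=(\sum_{i,j}|a_{ij}|^2)^{1/2}$. $\mathcal P(\mathbb R^n)$ is the set of measurable $p(\cdot):\mathbb R^n\to[1,\infty]$. For $p(\cdot)\in\mathcal P(\mathbb R^n)$ let $\Omega_\infty=\{x:p(x)=\infty\}$ and $F_p(g)=\int_{\mathbb R^n\setminus\Omega_\infty}|g(x)|^{p(x)}dx+\|g\|_{L^\infty(\Omega_\infty)}$; $L^{p(\cdot)}=L^{p(\cdot)}(\mathbb R^n)$ is the set of complex-valued measurable $f$ with $F_p(f/\eta)<\infty$ for some $\eta>0$, with norm $\|f\|_{L^{p(\cdot)}}=\inf\{\eta>0:F_p(f/\eta)\le1\}$. For a weight $\omega\ge 0$, $\|f\|_{L^{p(\cdot)}_\omega}=\|f\omega\|_{L^{p(\cdot)}}$. $q_-=\operatorname{ess\,inf}q$, $q_+=\operatorname{ess\,sup}q$ ($q_{i\pm}$ for $q_i$); $\mathcal P_b(\mathbb R^n)$ is the class of $q(\cdot)\in\mathcal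 P(\mathbb R^n)$ with $1<q_-\le q(x)\le q_+<\infty$ for all $x$. $\mathcal P_\infty(\mathbb R^n)$ is the set of $q(\cdot)\in\mathcal P(\mathbb R^n)$ for which there is a constant $q_\infty=\lim_{|x|\to\infty}q(x)$ ($q_{i\infty}$ for $q_i$). In $1/r$, $1/\infty=0$. For $\lambda\in\mathbb R$, $p(\cdot)\in\mathcal P_\infty(\mathbb R^n)$ and nonnegative locally integrable $\omega_1,\omega_2$, the two-weight $\lambda$-central Morrey space with variable exponent $\dot B^{p(\cdot),\lambda}_{\omega_1,\omega_2}$ is the class of locally integrable functions $f$ on $\mathbb R^n$ with $$\|f\|_{\dot B^{p(\cdot),\lambda}_{\omega_1,\omega_2}}=\sup_{R>0}\frac1{\omega_1(B(0,R))^{\lambda+\frac1{p_\infty}}}\|f\chi_{B(0,R)}\|_{L^{p(\cdot)}_{\omega_2}}<\infty,$$ where $\omega_1(B)=\int_B\omega_1(x)dx$ and $B(0,R)$ is the ball centered at $0$ with radius $R$. *)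

theory Defs
  imports "HOL-Analysis.Analysis" "HOL-Probability.Essential_Supremum"
begin

text \<open>
  Exponents take values in \<^typ>\<open>ennreal\<close>, where \<open>1 / \<infinity> = 0\<close>.
  Measurable means Lebesgue measurable throughout.
\<close>

definition rcp :: "ennreal \<Rightarrow> real" where
  "rcp r = enn2real (1 / r)"

definition exponents :: "('a::euclidean_space \<Rightarrow> ennreal) set" where
  "exponents = {p. p \<in> borel_measurable lebesgue \<and> (\<forall>x. 1 \<le> p x)}"

definition ess_inf :: "('a::euclidean_space \<Rightarrow> ennreal) \<Rightarrow> ennreal" where
  "ess_inf q = Liminf (ae_filter lebesgue) q"

definition ess_sup :: "('a::euclidean_space \<Rightarrow> ennreal) \<Rightarrow> ennreal" where
  "ess_sup q = esssup lebesgue q"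

definition exponents_b :: "('a::euclidean_space \<Rightarrow> ennreal) set" where
  "exponents_b =
     {q \<in> exponents. 1 < ess_inf q \<and> (\<forall>x. ess_inf q \<le> q x \<and> q x \<le> ess_sup q) \<and> ess_sup q < \<infinity>}"

definition exponents_inf :: "('a::euclidean_space \<Rightarrow> ennreal) set" where
  "exponents_inf = {q \<in> exponents. \<exists>c. (q \<longlongrightarrow> c) at_infinity}"

definition q_infty :: "('a::euclidean_space \<Rightarrow> ennreal) \<Rightarrow> ennreal" where
  "q_infty q = Lim at_infinity q"

text \<open>
  The modular \<open>F\<^sub>p\<close> and the Luxemburg norm of variable-exponent Lebesgue spaces. The norm is
  \<open>\<infinity>\<close> exactly when the function lies outside the space. The essential supremum over a null set
  is \<open>bot = 0\<close> in \<^typ>\<open>ennreal\<close>.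
\<close>

definition modular :: "('a::euclidean_space \<Rightarrow> ennreal) \<Rightarrow> ('a \<Rightarrow> complex) \<Rightarrow> ennreal" where
  "modular p g =
     (\<integral>\<^sup>+x\<in>- {x. p x = \<infinity>}. ennreal (norm (g x) powr enn2real (p x)) \<partial>lebesgue)
     + esssup (restrict_space lebesgue {x. p x = \<infinity>}) (\<lambda>x. ennreal (norm (g x)))"

definition Lp_norm :: "('a::euclidean_space \<Rightarrow> ennreal) \<Rightarrow> ('a \<Rightarrow> complex) \<Rightarrow> ennreal" where
  "Lp_norm p f =
     (INF \<eta>\<in>{\<eta>::real. 0 < \<eta> \<and> modular p (\<lambda>x. f x / of_real \<eta>) \<le> 1}. ennreal \<eta>)"

definition weighted_Lp_norm ::
  "('a::euclidean_space \<Rightarrow> ennreal) \<Rightarrow> ('a \<Rightarrow> real) \<Rightarrow> ('a \<Rightarrow> complex) \<Rightarrow> ennreal" where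
  "weighted_Lp_norm p \<omega> f = Lp_norm p (\<lambda>x. f x * of_real (\<omega> x))"

definition locally_integrable :: "('a::euclidean_space \<Rightarrow> complex) \<Rightarrow> bool" where
  "locally_integrable f \<longleftrightarrow>
     f \<in> borel_measurable lebesgue \<and> (\<forall>K. compact K \<longrightarrow> set_integrable lebesgue K f)"

text \<open>
  The integral of \<open>\<omega>\<^sub>1\<close> over the ball is a real-valued Bochner integral: the weight \<open>\<omega>\<^sub>1\<close> is meant to
  be nonnegative and locally integrable. Nothing is required of \<open>\<omega>\<^sub>2\<close>.
\<close>

definition morrey_norm ::
  "('a::euclidean_space \<Rightarrow> ennreal) \<Rightarrow> real \<Rightarrow> ('a \<Rightarrow> real) \<Rightarrow> ('a \<Rightarrow> real)
    \<Rightarrow> ('a \<Rightarrow> complex) \<Rightarrow> ennreal" where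
  "morrey_norm p lam \<omega>\<^sub>1 \<omega>\<^sub>2 f =
     (SUP R\<in>{0<..}.
        weighted_Lp_norm p \<omega>\<^sub>2 (\<lambda>x. f x * indicator (ball 0 R) x)
        / ennreal ((LINT x:ball 0 R|lebesgue. \<omega>\<^sub>1 x) powr (lam + rcp (q_infty p))))"

definition morrey_space ::
  "('a::euclidean_space \<Rightarrow> ennreal) \<Rightarrow> real \<Rightarrow> ('a \<Rightarrow> real) \<Rightarrow> ('a \<Rightarrow> real)
    \<Rightarrow> ('a \<Rightarrow> complex) set" where
  "morrey_space p lam \<omega>\<^sub>1 \<omega>\<^sub>2 = {f. locally_integrable f \<and> morrey_norm p lam \<omega>\<^sub>1 \<omega>\<^sub>2 f < \<infinity>}"

definition hausdorff_integrand ::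
  "(real^'n \<Rightarrow> real) \<Rightarrow> ('m::finite \<Rightarrow> real^'n \<Rightarrow> real^'n^'n) \<Rightarrow> ('m \<Rightarrow> real^'n \<Rightarrow> complex)
    \<Rightarrow> real^'n \<Rightarrow> real^'n \<Rightarrow> complex" where
  "hausdorff_integrand \<Phi> A f x t =
     of_real (\<Phi> t / norm t ^ CARD('n)) * (\<Prod>i\<in>UNIV. f i (A i t *v x))"

definition hausdorff ::
  "(real^'n \<Rightarrow> real) \<Rightarrow> ('m::finite \<Rightarrow> real^'n \<Rightarrow> real^'n^'n) \<Rightarrow> ('m \<Rightarrow> real^'n \<Rightarrow> complex)
    \<Rightarrow> real^'n \<Rightarrow> complex" where
  "hausdorff \<Phi> A f x = (\<integral>t. hausdorff_integrand \<Phi> A f x t \<partial>lebesgue)"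

text \<open>
  Boundedness is the norm inequality with finite constant; local integrability of the image is
  not part of it (and fails in general when some \<open>\<alpha>\<^sub>i\<close> is large). Since the Bochner integral is \<open>0\<close> where the integrand is not
  integrable, it is also required that the integral converges absolutely for almost every \<open>x\<close>
  and that the resulting function is measurable.
\<close>

definition hausdorff_bounded ::
  "(real^'n \<Rightarrow> real) \<Rightarrow> ('m::finite \<Rightarrow> real^'n \<Rightarrow> real^'n^'n)
    \<Rightarrow> ('m \<Rightarrow> (real^'n \<Rightarrow> complex) set) \<Rightarrow> ('m \<Rightarrow> (real^'n \<Rightarrow> complex) \<Rightarrow> ennreal)
    \<Rightarrow> ((real^'n \<Rightarrow> complex) \<Rightarrow> ennreal) \<Rightarrow> bool" where
  "hausdorff_bounded \<Phi> A X norm_X norm_Y \<longleftrightarrow>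
     (\<exists>C\<ge>0. \<forall>f. (\<forall>i. f i \<in> X i) \<longrightarrow>
        (AE x in lebesgue. integrable lebesgue (hausdorff_integrand \<Phi> A f x)) \<and>
        hausdorff \<Phi> A f \<in> borel_measurable lebesgue \<and>
        norm_Y (hausdorff \<Phi> A f) \<le> ennreal C * (\<Prod>i\<in>UNIV. norm_X i (f i)))"

text \<open>
  \<open>r_exp q A\<close> is the exponent \<open>r\<close> with \<open>1 / r(x) = 1 / q(A\<inverse> x) - 1 / q(x)\<close>; the subtraction in
  \<^typ>\<open>ennreal\<close> is genuine where \<open>q(A\<inverse> x) \<le> q(x)\<close>. The norm on \<^typ>\<open>real^'n^'n\<close> is the
  Frobenius norm.
\<close>

definition r_exp :: "(real^'n \<Rightarrow> ennreal) \<Rightarrow> real^'n^'n \<Rightarrow> real^'n \<Rightarrow> ennreal" where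
  "r_exp q A x = 1 / (1 / q (matrix_inv A *v x) - 1 / q x)"

definition c_const :: "real^'n^'n \<Rightarrow> (real^'n \<Rightarrow> ennreal) \<Rightarrow> real \<Rightarrow> real" where
  "c_const A q \<alpha> =
     max (norm A powr (- \<alpha>)) (norm (matrix_inv A) powr \<alpha>) *
     max (\<bar>det (matrix_inv A)\<bar> powr rcp (ess_sup q)) (\<bar>det (matrix_inv A)\<bar> powr rcp (ess_inf q))"

end

theory Submission
  imports Defs "HOL-Probability.Probability_Measure"
begin

text \<open>
  The estimate is made on one ball \<open>B(0,R)\<close> at a time, and first for one value of \<open>t\<close>.
  Since \<open>1/q = \<Sum>\<^sub>i 1/q\<^sub>i\<close>, Hoelder's inequality reduces the norm of
  \<open>\<Prod>\<^sub>i f\<^sub>i(A\<^sub>i(t)x)\<close> with weight \<open>|x|\<^sup>\<alpha>\<close> to the norms of the single factors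
  \<open>f\<^sub>i(A\<^sub>i(t)x) |x|\<^sup>\<alpha>\<^sup>i\<close> on the ball. The substitution \<open>y = A\<^sub>i(t) x\<close> moves such a factor to
  the ball of radius \<open>\<parallel>A\<^sub>i(t)\<parallel> R\<close>; the Jacobian and the change of the power weight are what
  \<^const>\<open>c_const\<close> measures, and the exponent becomes \<open>q\<^sub>i(A\<^sub>i(t)\<inverse> y) \<le> q\<^sub>i(y)\<close>. One more Hoelder
  inequality, with third exponent \<^const>\<open>r_exp\<close>, returns to the exponent \<open>q\<^sub>i\<close> at the price of
  the norm of the constant function \<open>1\<close> (\<open>modular_embedding\<close>, \<open>modular_dilation\<close>,
  \<open>kernel_modular_le\<close>). By the definition of the Morrey norm and because
  \<open>\<omega>\<^sub>i(B(0,\<rho>))\<close> is a multiple of \<open>\<rho>\<close> to the power \<open>n + \<gamma>\<^sub>i\<close>, the result is the integrand of the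
  hypothesis times \<open>\<Prod>\<^sub>i \<parallel>f\<^sub>i\<parallel>\<close> and a power of \<open>R\<close>. The relations between the parameters
  say exactly that this power is the one in the Morrey norm of the target.

  The integral over \<open>t\<close> is brought out of the norm by a Minkowski inequality,
  \<open>minkowski_modular\<close>. It follows directly from the convexity of \<open>s \<mapsto> s\<^sup>q\<^sup>(\<^sup>x\<^sup>)\<close>: with
  \<open>M(t)\<close> just above the norm of the slice at \<open>t\<close>, Jensen's inequality for the probability density
  \<open>M / \<integral>M\<close> bounds the modular of \<open>\<integral> K(x,t) dt / \<integral>M\<close> by an average of modulars that are at
  most \<open>1\<close>. All inequalities between norms are obtained as inequalities
  between modulars; the constants \<open>2\<close> and \<open>2m\<close> that the Hoelder inequalities lose enter the operator bound.

  Two measure-theoretic points need care. The functions are only Lebesgue measurable, so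
  \<open>f\<^sub>i(A\<^sub>i(t)x)\<close> is replaced by a jointly measurable function that agrees with it almost everywhere, in either
  order of the variables (\<open>hausdorff_integrand_representative\<close>); this uses that invertible matrices
  preserve null sets. The integrand of the hypothesis enters only as an upper bound for the norm of
  the slice at \<open>t\<close>, which is measurable, so that the finiteness of its lower integral suffices.
\<close>

section \<open>Linear changes of variables for Lebesgue measure\<close>

lemma det_shear:
  fixes m n :: "'n::finite"
  assumes "m \<noteq> n"
  shows "det (matrix (\<lambda>x::real^'n. \<chi> i. if i = m then x$m + x$n else x$i)) = 1"
proof -
  have "matrix (\<lambda>x::real^'n. \<chi> i. if i = m then x$m + x$n else x$i)
      = (\<chi> k. if k = m then row m (mat 1) + 1 *s row n (mat 1) else row k (mat 1))"
    using assms by (auto simp: vec_eq_iff matrix_def axis_def row_def mat_def)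
  then show ?thesis
    using det_row_operation[OF assms, of "mat 1 :: real^'n^'n" 1] by (simp only: det_I)
qed

text \<open>
  A translation by \<open>v\<close> puts the \<open>n\<close>-th coordinate of the lower corner at \<open>0\<close>, where
  \<open>measure_shear_interval\<close> applies; the shear turns it into a translation by \<open>-w\<close>.
\<close>

lemma measure_shear_cbox:
  fixes a b :: "real^'n"
  assumes mn: "m \<noteq> n"
  defines "h \<equiv> \<lambda>x::real^'n. \<chi> i. if i = m then x$m + x$n else x$i"
  shows "measure lebesgue (h ` cbox a b) = measure lebesgue (cbox a b)"
proof (cases "cbox a b = {}")
  case False
  define v w where "v = (\<chi> i. if i = n then - a$n else 0)"
    and "w = (\<chi> i. if i = m \<or> i = n then a$n else 0)"
  have "h = (+) w \<circ> h \<circ> (+) v"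
    using mn by (auto simp: h_def v_def w_def vec_eq_iff)
  then have "h ` cbox a b = (+) w ` h ` cbox (v + a) (v + b)"
    by (metis cbox_translation image_comp)
  then have "measure lebesgue (h ` cbox a b) = measure lebesgue (h ` cbox (v + a) (v + b))"
    using measure_translation by metis
  also have "\<dots> = measure lebesgue (cbox (v + a) (v + b))"
    unfolding h_def
  proof (rule measure_shear_interval[OF mn])
    show "cbox (v + a) (v + b) \<noteq> {}"
      using False by (simp add: cbox_translation)
  qed (simp add: v_def)
  also have "\<dots> = measure lebesgue (cbox a b)"
    using measure_translation[of v "cbox a b"] by (simp only: cbox_translation[symmetric])
  finally show ?thesis .
qed simp

lemma nn_integral_shear:
  fixes h :: "real^'n \<Rightarrow> ennreal"
  assumes mn: "m \<noteq> n" and h: "h \<in> borel_measurable borel"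
  shows "(\<integral>\<^sup>+x. h x \<partial>lborel) = (\<integral>\<^sup>+x. h (\<chi> i. if i = m then x$m + x$n else x$i) \<partial>lborel)"
proof -
  define f where "f = (\<lambda>x::real^'n. \<chi> i. if i = m then x$m + x$n else x$i)"
  have lin: "linear f"
    by (rule linearI) (auto simp: f_def vec_eq_iff algebra_simps)
  have [measurable]: "f \<in> borel_measurable borel"
    by (intro borel_measurable_continuous_onI linear_continuous_on linear_conv_bounded_linear[THEN iffD1] lin)
  have inj: "inj f"
    using det_nz_iff_inj[OF lin] det_shear[OF mn] by (simp add: f_def)
  then have "surj f"
    using lin linear_injective_imp_surjective by blast
  have "lborel = distr lborel borel f"
  proof (rule lborel_eqI)
    fix l u :: "real^'n" assume le: "\<And>b. b \<in> Basis \<Longrightarrow> l \<bullet> b \<le> u \<bullet> b"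
    let ?S = "f -` box l u"
    obtain g where g: "linear g" "\<And>x. g (f x) = x"
      using linear_injective_left_inverse[OF lin inj] by (auto simp: fun_eq_iff)
    have "?S \<subseteq> g ` box l u"
      by (auto intro!: image_eqI[where x="f _"] simp: g(2))
    then have "bounded ?S"
      using g(1) by (meson bounded_box bounded_linear_image bounded_subset linear_conv_bounded_linear)
    moreover have "open ?S"
      by (intro open_vimage open_box linear_continuous_on linear_conv_bounded_linear[THEN iffD1] lin)
    ultimately have "?S \<in> lmeasurable"
      by (rule lmeasurable_open)
    then have "measure lebesgue ?S = measure lebesgue (f ` ?S)"
      using measure_linear_sufficient[OF lin, of ?S 1] measure_shear_cbox[OF mn, folded f_def]
      by simp
    also have "f ` ?S = box l u"
      using \<open>surj f\<close> by simp
    finally have "emeasure lebesgue ?S = emeasure lebesgue (box l u)"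
      using \<open>?S \<in> lmeasurable\<close> by (simp add: emeasure_eq_measure2)
    then show "emeasure (distr lborel borel f) (box l u) = (\<Prod>b\<in>Basis. (u - l) \<bullet> b)"
      using le \<open>open ?S\<close> by (simp add: emeasure_distr emeasure_lborel_box_eq)
  qed simp
  then have "(\<integral>\<^sup>+x. h x \<partial>lborel) = (\<integral>\<^sup>+x. h x \<partial>distr lborel borel f)"
    by simp
  also have "\<dots> = (\<integral>\<^sup>+x. h (f x) \<partial>lborel)"
    using h by (subst nn_integral_distr) auto
  finally show ?thesis by (simp add: f_def)
qed

lemma nn_integral_transpose_coordinates:
  fixes h :: "real^'n \<Rightarrow> ennreal"
  assumes h: "h \<in> borel_measurable borel"
  shows "(\<integral>\<^sup>+x. h x \<partial>lborel) = (\<integral>\<^sup>+x. h (\<chi> i. x $ Transposition.transpose m n i) \<partial>lborel)"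
proof -
  define f where "f = (\<lambda>x::real^'n. \<chi> i. x $ Transposition.transpose m n i)"
  have lin: "linear f"
    by (rule linearI) (auto simp: f_def vec_eq_iff algebra_simps)
  have [measurable]: "f \<in> borel_measurable borel"
    by (intro borel_measurable_continuous_onI linear_continuous_on linear_conv_bounded_linear[THEN iffD1] lin)
  have "lborel = distr lborel borel f"
  proof (rule lborel_eqI)
    fix l u :: "real^'n" assume le: "\<And>b. b \<in> Basis \<Longrightarrow> l \<bullet> b \<le> u \<bullet> b"
    have S: "f -` box l u = box (f l) (f u)"
      by (auto simp: f_def mem_box_cart) (metis transpose_involutory)+
    have le': "l $ i \<le> u $ i" for i
      using le[of "axis i 1"] by (simp add: axis_in_Basis_iff inner_axis)
    have "emeasure lborel (box (f l) (f u)) = ennreal (\<Prod>b\<in>Basis. (f u - f l) \<bullet> b)"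
      using le' by (auto simp: emeasure_lborel_box_eq f_def Basis_vec_def inner_axis)
    also have "(\<Prod>b\<in>Basis. (f u - f l) \<bullet> b) = (\<Prod>i\<in>UNIV. (u - l) $ Transposition.transpose m n i)"
      by (simp add: f_def inner_axis prod.UNION_disjoint Basis_vec_def axis_eq_axis prod.reindex)
    also have "\<dots> = (\<Prod>i\<in>UNIV. (u - l) $ i)"
      using prod.permute[OF permutes_swap_id, of m UNIV n "\<lambda>i. (u - l) $ i"] by (simp add: comp_def)
    also have "\<dots> = (\<Prod>b\<in>Basis. (u - l) \<bullet> b)"
      by (simp add: inner_axis prod.UNION_disjoint Basis_vec_def axis_eq_axis prod.reindex)
    finally show "emeasure (distr lborel borel f) (box l u) = (\<Prod>b\<in>Basis. (u - l) \<bullet> b)"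
      by (simp add: emeasure_distr S)
  qed simp
  then have "(\<integral>\<^sup>+x. h x \<partial>lborel) = (\<integral>\<^sup>+x. h x \<partial>distr lborel borel f)"
    by simp
  also have "\<dots> = (\<integral>\<^sup>+x. h (f x) \<partial>lborel)"
    using h by (subst nn_integral_distr) auto
  finally show ?thesis by (simp add: f_def)
qed

lemma det_transpose_coordinates:
  fixes m n :: "'n::finite"
  shows "\<bar>det (matrix (\<lambda>x::real^'n. \<chi> i. x $ Transposition.transpose m n i))\<bar> = 1"
proof -
  have "matrix (\<lambda>x::real^'n. \<chi> i. x $ Transposition.transpose m n i)
      = (\<chi> i. (mat 1 :: real^'n^'n) $ Transposition.transpose m n i)"
    by (auto simp: vec_eq_iff matrix_def axis_def mat_def)
  then show ?thesis
    using det_permute_rows[OF permutes_swap_id[of m UNIV n], of "mat 1 :: real^'n^'n"]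
    by (simp add: abs_mult sign_swap_id)
qed

lemma nn_integral_stretch:
  fixes h :: "real^'n \<Rightarrow> ennreal"
  assumes c: "\<And>i. c i \<noteq> 0" and [measurable]: "h \<in> borel_measurable borel"
  shows "(\<integral>\<^sup>+x. h x \<partial>lborel) = ennreal \<bar>\<Prod>i\<in>UNIV. c i\<bar> * (\<integral>\<^sup>+x. h (\<chi> i. c i * x $ i) \<partial>lborel)"
proof -
  define d where "d b = c (SOME i. b = axis i 1)" for b :: "real^'n"
  have d: "d (axis i 1) = c i" for i
    by (simp add: d_def axis_eq_axis)
  have T: "0 + (\<Sum>j\<in>Basis. (d j * (x \<bullet> j)) *\<^sub>R j) = (\<chi> i. c i * x $ i)" for x
  proof -
    have "(\<Sum>j\<in>Basis. (d j * (x \<bullet> j)) *\<^sub>R j) = (\<Sum>i\<in>UNIV. (c i * x $ i) *\<^sub>R axis i 1)"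
      by (simp add: inner_axis Basis_vec_def axis_eq_axis sum.UNION_disjoint d)
    then show ?thesis
      by (simp add: vec_eq_iff axis_def if_distrib[of "\<lambda>z. _ * z"] cong: if_cong)
  qed
  have [measurable]: "(\<lambda>x::real^'n. \<chi> i. c i * x $ i) \<in> borel_measurable borel"
    by (intro borel_measurable_continuous_onI continuous_intros)
  have "(\<Prod>j\<in>Basis. \<bar>d j\<bar>) = \<bar>\<Prod>i\<in>UNIV. c i\<bar>"
    by (simp add: Basis_vec_def axis_eq_axis prod.UNION_disjoint d abs_prod)
  moreover have "lborel = density (distr lborel borel (\<lambda>x. 0 + (\<Sum>j\<in>Basis. (d j * (x \<bullet> j)) *\<^sub>R j)))
      (\<lambda>_. (\<Prod>j\<in>Basis. \<bar>d j\<bar>))"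
    by (rule lborel_affine_euclidean) (auto simp: Basis_vec_def d c)
  ultimately have eq: "lborel = density (distr lborel borel (\<lambda>x. \<chi> i. c i * x $ i)) (\<lambda>_. ennreal \<bar>\<Prod>i\<in>UNIV. c i\<bar>)"
    by (simp only: T)
  have "(\<integral>\<^sup>+x. h x \<partial>lborel) = (\<integral>\<^sup>+x. h x \<partial>density (distr lborel borel (\<lambda>x. \<chi> i. c i * x $ i)) (\<lambda>_. ennreal \<bar>\<Prod>i\<in>UNIV. c i\<bar>))"
    by (simp only: eq[symmetric])
  also have "\<dots> = ennreal \<bar>\<Prod>i\<in>UNIV. c i\<bar> * (\<integral>\<^sup>+x. h (\<chi> i. c i * x $ i) \<partial>lborel)"
    by (simp add: nn_integral_density nn_integral_distr nn_integral_cmult)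
  finally show ?thesis .
qed

text \<open>
  Linear maps are compositions of coordinate scalings, transpositions of coordinates, shears and
  singular maps. The determinant is multiplicative, so it is enough to
  check the substitution rule on these generators.
\<close>

lemma nn_integral_linear_borel:
  fixes f :: "real^'n \<Rightarrow> real^'n" and h :: "real^'n \<Rightarrow> ennreal"
  assumes "linear f" and "det (matrix f) \<noteq> 0" and "h \<in> borel_measurable borel"
  shows "(\<integral>\<^sup>+x. h x \<partial>lborel) = ennreal \<bar>det (matrix f)\<bar> * (\<integral>\<^sup>+x. h (f x) \<partial>lborel)"
proof -
  define P where "P f \<longleftrightarrow> (\<forall>h. det (matrix f) \<noteq> 0 \<longrightarrow> h \<in> borel_measurable borel \<longrightarrow>
      (\<integral>\<^sup>+x. h x \<partial>lborel) = ennreal \<bar>det (matrix f)\<bar> * (\<integral>\<^sup>+x. h (f x) \<partial>lborel))"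
    for f :: "real^'n \<Rightarrow> real^'n"
  have "P f"
    using \<open>linear f\<close>
  proof (rule induct_linear_elementary)
    fix f g :: "real^'n \<Rightarrow> real^'n"
    assume lin: "linear f" "linear g" and P: "P f" "P g"
    have [measurable]: "f \<in> borel_measurable borel"
      by (intro borel_measurable_continuous_onI linear_continuous_on linear_conv_bounded_linear[THEN iffD1] lin)
    have det: "det (matrix (f \<circ> g)) = det (matrix f) * det (matrix g)"
      by (simp add: matrix_compose lin det_mul)
    show "P (f \<circ> g)"
      unfolding P_def
    proof (intro allI impI)
      fix h :: "real^'n \<Rightarrow> ennreal"
      assume nz: "det (matrix (f \<circ> g)) \<noteq> 0" and h [measurable]: "h \<in> borel_measurable borel"
      have "(\<integral>\<^sup>+x. h x \<partial>lborel) = ennreal \<bar>det (matrix f)\<bar> * (\<integral>\<^sup>+x. h (f x) \<partial>lborel)"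
        by (rule P(1)[unfolded P_def, rule_format, OF _ h]) (use nz det in simp)
      also have "(\<integral>\<^sup>+x. h (f x) \<partial>lborel) = ennreal \<bar>det (matrix g)\<bar> * (\<integral>\<^sup>+x. h (f (g x)) \<partial>lborel)"
        by (rule P(2)[unfolded P_def, rule_format]) (use nz det in simp_all)
      finally show "(\<integral>\<^sup>+x. h x \<partial>lborel)
          = ennreal \<bar>det (matrix (f \<circ> g))\<bar> * (\<integral>\<^sup>+x. h ((f \<circ> g) x) \<partial>lborel)"
        by (simp add: det abs_mult ennreal_mult mult.assoc)
    qed
  next
    fix f :: "real^'n \<Rightarrow> real^'n" and i
    assume lin: "linear f" and z: "\<And>x. f x $ i = 0"
    have "f x \<noteq> axis i 1" for x
      using z[of x] by (metis axis_nth zero_neq_one)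
    then have "\<not> surj f"
      by (metis surjD)
    then have "det (matrix f) = 0"
      using det_nz_iff_inj[OF lin] linear_injective_imp_surjective[OF lin] by blast
    then show "P f" by (simp add: P_def)
  next
    fix c :: "'n \<Rightarrow> real"
    have det: "det (matrix (\<lambda>x::real^'n. \<chi> i. c i * x $ i)) = (\<Prod>i\<in>UNIV. c i)"
      by (simp add: matrix_def axis_def det_diagonal)
    show "P (\<lambda>x. \<chi> i. c i * x $ i)"
      unfolding P_def det by (auto intro!: nn_integral_stretch[of c])
  next
    fix m n :: 'n
    show "P (\<lambda>x. \<chi> i. x $ Transposition.transpose m n i)"
      unfolding P_def det_transpose_coordinates
      by (auto intro!: nn_integral_transpose_coordinates)
  next
    fix m n :: 'n
    assume "m \<noteq> n"
    then show "P (\<lambda>x. \<chi> i. if i = m then x $ m + x $ n else x $ i)"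
      unfolding P_def det_shear[OF \<open>m \<noteq> n\<close>] 
      by (auto intro!: nn_integral_shear[OF \<open>m \<noteq> n\<close>])
  qed
  then show ?thesis
    unfolding P_def using assms(2,3) by blast
qed

text \<open>
  The Borel substitution rule shows that preimages of null sets are null, which is what
  carries measurability and integrals over to the completion.
\<close>

lemma
  fixes A :: "real^'n^'n"
  assumes "invertible A"
  shows invertible_measurable_lebesgue: "(\<lambda>x. A *v x) \<in> lebesgue \<rightarrow>\<^sub>M lebesgue"
    and AE_lebesgue_invertible: "(AE x in lebesgue. P x) \<Longrightarrow> (AE x in lebesgue. P (A *v x))"
    and nn_integral_lebesgue_invertible: "h \<in> borel_measurable lebesgue \<Longrightarrow>
      (\<integral>\<^sup>+x. h x \<partial>lebesgue) = ennreal \<bar>det A\<bar> * (\<integral>\<^sup>+x. h (A *v x) \<partial>lebesgue)"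
proof -
  have det: "det A \<noteq> 0"
    using assms invertible_det_nz by blast
  have meas: "(\<lambda>x. A *v x) \<in> borel_measurable borel"
    by (intro borel_measurable_continuous_onI matrix_vector_mult_linear_continuous_on)
  have cov: "(\<integral>\<^sup>+x. h x \<partial>lborel) = ennreal \<bar>det A\<bar> * (\<integral>\<^sup>+x. h (A *v x) \<partial>lborel)"
    if "h \<in> borel_measurable borel" for h
    using nn_integral_linear_borel[OF matrix_vector_mul_linear, of A h] that det by simp
  have null: "(\<lambda>x. A *v x) -` N \<in> null_sets lborel" if N: "N \<in> null_sets lborel" for N
  proof -
    have NB: "N \<in> sets borel" using N by auto
    have "ennreal \<bar>det A\<bar> * (\<integral>\<^sup>+x. indicator N (A *v x) \<partial>lborel) = 0"
      using cov[of "indicator N"] NB N by (auto simp: null_sets_def)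
    then have "(\<integral>\<^sup>+x. indicator N (A *v x) \<partial>lborel) = 0"
      using det by (simp add: ennreal_eq_0_iff)
    moreover have "(\<integral>\<^sup>+x. indicator N (A *v x) \<partial>lborel) = (\<integral>\<^sup>+x. indicator ((\<lambda>x. A *v x) -` N) x \<partial>lborel)"
      by (simp add: indicator_def)
    moreover have "(\<lambda>x. A *v x) -` N \<in> sets borel"
      using measurable_sets[OF meas NB] by simp
    ultimately show ?thesis
      by (simp add: null_sets_def)
  qed
  have ml: "(\<lambda>x. A *v x) \<in> lebesgue \<rightarrow>\<^sub>M lborel"
    using meas by (simp add: measurable_completion)
  have nsub: "null_sets lborel \<subseteq> null_sets (distr lebesgue lborel (\<lambda>x. A *v x))"
  proof
    fix N :: "(real^'n) set" assume N: "N \<in> null_sets lborel"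
    then show "N \<in> null_sets (distr lebesgue lborel (\<lambda>x. A *v x))"
      using null[OF N] ml by (auto simp: null_sets_distr_iff null_sets_completionI)
  qed
  show m: "(\<lambda>x. A *v x) \<in> lebesgue \<rightarrow>\<^sub>M lebesgue"
    by (rule completion.measurable_completion2[OF ml nsub])
  have ae: "AE x in lebesgue. P (A *v x)" if P: "AE x in lebesgue. P x" for P
  proof -
    have "AE x in lborel. P x" using P by (simp add: AE_completion_iff)
    then obtain N where N: "{x. \<not> P x} \<subseteq> N" "N \<in> null_sets lborel"
      by (auto elim!: AE_E simp: null_sets_def)
    have "AE x in lborel. P (A *v x)"
      using N by (intro AE_I'[OF null[OF N(2)]]) auto
    then show ?thesis by (rule AE_completion)
  qed
  then show "(AE x in lebesgue. P x) \<Longrightarrow> (AE x in lebesgue. P (A *v x))" .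
  assume h: "h \<in> borel_measurable lebesgue"
  obtain g where g: "g \<in> borel_measurable lborel" "AE x in lborel. h x = g x"
    using completion_ex_borel_measurable[OF h] by blast
  have hg: "AE x in lebesgue. h x = g x"
    using g(2) by (rule AE_completion)
  have "(\<integral>\<^sup>+x. h x \<partial>lebesgue) = (\<integral>\<^sup>+x. g x \<partial>lborel)"
    using nn_integral_cong_AE[OF hg] by (simp add: nn_integral_completion)
  also have "\<dots> = ennreal \<bar>det A\<bar> * (\<integral>\<^sup>+x. g (A *v x) \<partial>lborel)"
    using g by (intro cov) simp
  also have "(\<integral>\<^sup>+x. g (A *v x) \<partial>lborel) = (\<integral>\<^sup>+x. h (A *v x) \<partial>lebesgue)"
    using nn_integral_cong_AE[OF ae[OF hg]] by (simp add: nn_integral_completion)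
  finally show "(\<integral>\<^sup>+x. h x \<partial>lebesgue) = ennreal \<bar>det A\<bar> * (\<integral>\<^sup>+x. h (A *v x) \<partial>lebesgue)" .
qed

lemma norm_matrix_vector_mult_le:
  fixes A :: "real^'n^'m"
  shows "norm (A *v x) \<le> norm A * norm x"
proof -
  have "norm (A *v x) \<le> L2_set (\<lambda>i. norm (A $ i) * norm x) UNIV"
    unfolding norm_vec_def
  proof (rule L2_set_mono)
    fix i
    show "norm ((A *v x) $ i) \<le> L2_set (\<lambda>j. norm (A $ i $ j)) UNIV * L2_set (\<lambda>j. norm (x $ j)) UNIV"
      using Cauchy_Schwarz_ineq2[of "A $ i" x]
      by (simp add: matrix_vector_mul_component norm_vec_def)
  qed simp
  also have "\<dots> = norm A * norm x"
    by (simp add: L2_set_left_distrib[symmetric] norm_vec_def[of A])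
  finally show ?thesis .
qed

lemma invertible_matrix_inv:
  fixes A :: "real^'n^'n"
  assumes "invertible A"
  shows "A ** matrix_inv A = mat 1" "matrix_inv A ** A = mat 1" "invertible (matrix_inv A)"
proof -
  have "A ** matrix_inv A = mat 1 \<and> matrix_inv A ** A = mat 1"
    using assms unfolding invertible_def matrix_inv_def by (rule someI_ex)
  then show "A ** matrix_inv A = mat 1" "matrix_inv A ** A = mat 1" "invertible (matrix_inv A)"
    unfolding invertible_def by auto
qed

lemma invertible_imp_nonzero:
  fixes A :: "real^'n^'n"
  assumes "invertible A"
  shows "A \<noteq> 0"
proof
  assume "A = 0"
  have "A *v (matrix_inv A *v axis undefined 1) = (axis undefined 1 :: real^'n)"
    using invertible_matrix_inv(1)[OF assms] by (simp add: matrix_vector_mul_assoc)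
  then have "(axis undefined 1 :: real^'n) = 0"
    by (simp add: \<open>A = 0\<close>)
  then show False
    by (simp add: axis_eq_0_iff)
qed

lemma measurable_matrix_vector_mult [measurable (raw)]:
  fixes A :: "'a \<Rightarrow> real^'n^'m" and x :: "'a \<Rightarrow> real^'n"
  assumes "A \<in> borel_measurable M" "x \<in> borel_measurable M"
  shows "(\<lambda>p. A p *v x p) \<in> borel_measurable M"
proof -
  have "bounded_bilinear ((*v) :: real^'n^'m \<Rightarrow> real^'n \<Rightarrow> real^'m)"
  proof
    show "\<exists>K. \<forall>(A::real^'n^'m) x. norm (A *v x) \<le> norm A * norm x * K"
      using norm_matrix_vector_mult_le by (intro exI[of _ 1]) auto
  qed (simp_all add: matrix_vector_mult_add_rdistrib matrix_vector_right_distrib matrix_vector_mult_scaleR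
      flip: scaleR_matrix_vector_assoc)
  then have "continuous_on UNIV (\<lambda>p::(real^'n^'m) \<times> (real^'n). fst p *v snd p)"
    by (rule bounded_bilinear.continuous_on) (rule continuous_on_fst continuous_on_snd continuous_on_id)+
  then have "(\<lambda>p::(real^'n^'m) \<times> (real^'n). fst p *v snd p) \<in> borel_measurable borel"
    by (rule borel_measurable_continuous_onI)
  from measurable_compose[OF borel_measurable_Pair[OF assms] this] show ?thesis
    by simp
qed

section \<open>Balls weighted by a power of the norm\<close>

lemma nn_integral_scale_lborel:
  fixes h :: "'a::euclidean_space \<Rightarrow> ennreal"
  assumes c: "0 < c" and [measurable]: "h \<in> borel_measurable borel"
  shows "(\<integral>\<^sup>+x. h x \<partial>lborel) = ennreal (c ^ DIM('a)) * (\<integral>\<^sup>+x. h (c *\<^sub>R x) \<partial>lborel)"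
proof -
  have eq: "lborel = density (distr lborel borel (\<lambda>x::'a. 0 + c *\<^sub>R x)) (\<lambda>_. ennreal (\<bar>c\<bar>^DIM('a)))"
    using c by (intro lborel_affine) auto
  have "(\<integral>\<^sup>+x. h x \<partial>lborel)
      = (\<integral>\<^sup>+x. h x \<partial>density (distr lborel borel (\<lambda>x::'a. 0 + c *\<^sub>R x)) (\<lambda>_. ennreal (\<bar>c\<bar>^DIM('a))))"
    by (simp only: eq[symmetric])
  also have "\<dots> = ennreal (c ^ DIM('a)) * (\<integral>\<^sup>+x. h (c *\<^sub>R x) \<partial>lborel)"
    using c by (simp add: nn_integral_density nn_integral_distr nn_integral_cmult)
  finally show ?thesis .
qed

lemma nn_integral_norm_powr_scale:
  fixes S T :: "'a::euclidean_space set" and g :: real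
  assumes c: "0 < c" and [measurable]: "S \<in> sets borel" "T \<in> sets borel"
    and ST: "\<And>x. c *\<^sub>R x \<in> S \<longleftrightarrow> x \<in> T"
  shows "(\<integral>\<^sup>+x. ennreal (norm x powr g) * indicator S x \<partial>lborel)
    = ennreal (c powr (DIM('a) + g)) * (\<integral>\<^sup>+x. ennreal (norm x powr g) * indicator T x \<partial>lborel)"
proof -
  have eq: "ennreal (norm (c *\<^sub>R x) powr g) * indicator S (c *\<^sub>R x)
      = ennreal (c powr g) * (ennreal (norm x powr g) * indicator T x)" for x
    using c ST[of x] by (auto simp: powr_mult ennreal_mult indicator_def)
  have "(\<integral>\<^sup>+x. ennreal (norm x powr g) * indicator S x \<partial>lborel)
      = ennreal (c ^ DIM('a)) * (\<integral>\<^sup>+x. ennreal (c powr g) * (ennreal (norm x powr g) * indicator T x) \<partial>lborel)"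
    unfolding eq[symmetric] by (rule nn_integral_scale_lborel[OF c]) simp
  then show ?thesis
    using c by (simp add: nn_integral_cmult powr_add powr_realpow ennreal_mult mult.assoc)
qed

text \<open>
  The integral over the unit ball is a sum over the dyadic annuli \<open>2\<^sup>-\<^sup>k\<^sup>-\<^sup>1 \<le> |x| < 2\<^sup>-\<^sup>k\<close>. By
  homogeneity the \<open>k\<close>-th term is the first one times \<open>2\<^sup>-\<^sup>k\<^sup>(\<^sup>n\<^sup>+\<^sup>g\<^sup>)\<close>, so the series is geometric with
  ratio below \<open>1\<close> exactly when \<open>g > -n\<close>.
\<close>

lemma nn_integral_norm_powr_unit_ball:
  fixes g :: real
  assumes g: "- real DIM('a::euclidean_space) < g"
  defines "I \<equiv> (\<integral>\<^sup>+x. ennreal (norm x powr g) * indicator (ball (0::'a) 1) x \<partial>lborel)"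
  shows "0 < I" and "I < \<infinity>"
proof -
  have "\<not> (AE x in lborel. ennreal (norm x powr g) * indicator (ball (0::'a) 1) x = 0)"
  proof
    assume *: "AE x in lborel. ennreal (norm x powr g) * indicator (ball (0::'a) 1) x = 0"
    have "AE x in lborel. x \<notin> ball (0::'a) 1"
      using * AE_lborel_singleton[of "0::'a"] by eventually_elim (auto simp: indicator_def)
    then have "emeasure lborel (ball (0::'a) 1) = 0"
      by (subst (asm) AE_iff_measurable[OF _ refl]) (auto simp: ball_def)
    then have "negligible (ball (0::'a) 1)"
      by (simp add: negligible_iff_emeasure0)
    then show False
      using open_not_negligible[of "ball (0::'a) 1"] by simp
  qed
  then have "I \<noteq> 0"
    unfolding I_def by (subst nn_integral_0_iff_AE) (measurable, auto)
  then show "0 < I"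
    by (simp add: zero_less_iff_neq_zero)
next
  define An where "An = (\<lambda>k. {x::'a. (1/2) ^ Suc k \<le> norm x \<and> norm x < (1/2) ^ k})"
  define q where "q = (1/2::real) powr (DIM('a) + g)"
  define J where "J = (\<integral>\<^sup>+x. ennreal (norm x powr g) * indicator (An 0) x \<partial>lborel)"
  have q: "0 \<le> q" "q < 1"
    using g powr_less_mono2[of "DIM('a) + g" "1/2" 1] by (auto simp: q_def)
  have [measurable]: "An k \<in> sets borel" for k
    unfolding An_def by measurable
  have "J \<le> (\<integral>\<^sup>+x. ennreal (max 1 (2 powr (-g))) * indicator (ball (0::'a) 1) x \<partial>lborel)"
    unfolding J_def
  proof (intro nn_integral_mono)
    fix x :: 'a
    have "norm x powr g \<le> max 1 (2 powr (-g))" if "1/2 \<le> norm x" "norm x < 1"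
    proof (cases "0 \<le> g")
      case True
      then have "norm x powr g \<le> 1 powr g"
        using that by (intro powr_mono2) auto
      then show ?thesis by simp
    next
      case False
      then have "norm x powr g \<le> (1/2) powr g"
        using that by (intro powr_mono2') auto
      then show ?thesis by (simp add: powr_minus_divide powr_divide)
    qed
    then show "ennreal (norm x powr g) * indicator (An 0) x
        \<le> ennreal (max 1 (2 powr (-g))) * indicator (ball (0::'a) 1) x"
      by (auto simp: An_def indicator_def intro!: ennreal_leI)
  qed
  also have "\<dots> = ennreal (max 1 (2 powr (-g))) * emeasure lborel (ball (0::'a) 1)"
    by (subst nn_integral_cmult_indicator) auto
  also have "\<dots> < \<infinity>"
    using emeasure_lborel_ball_finite[of "0::'a" 1] by (simp add: ennreal_mult_less_top)
  finally have J: "J < \<infinity>" .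
  have An: "(\<integral>\<^sup>+x. ennreal (norm x powr g) * indicator (An k) x \<partial>lborel) = ennreal (q ^ k) * J" for k
  proof -
    have "((1/2::real) ^ k) powr (DIM('a) + g) = q ^ k"
      by (simp add: q_def powr_realpow[symmetric] powr_powr mult.commute)
    moreover have "(1/2) ^ k *\<^sub>R x \<in> An k \<longleftrightarrow> x \<in> An 0" for x
      by (simp add: An_def field_simps)
    ultimately show ?thesis
      unfolding J_def by (subst nn_integral_norm_powr_scale[of "(1/2)^k" "An k" "An 0"]) auto
  qed
  have "I \<le> (\<integral>\<^sup>+x. (\<Sum>k. ennreal (norm x powr g) * indicator (An k) x) \<partial>lborel)"
    unfolding I_def
  proof (intro nn_integral_mono)
    fix x :: 'a
    show "ennreal (norm x powr g) * indicator (ball 0 1) x \<le> (\<Sum>k. ennreal (norm x powr g) * indicator (An k) x)"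
    proof (cases "x \<noteq> 0 \<and> norm x < 1")
      case True
      have ex: "\<exists>k. (1/2::real) ^ k \<le> norm x"
        using True real_arch_pow_inv[of "norm x" "1/2"] by (auto intro: less_imp_le)
      define k where "k = (LEAST k. (1/2::real) ^ k \<le> norm x)"
      have k: "(1/2::real) ^ k \<le> norm x"
        unfolding k_def using ex by (rule LeastI_ex)
      then have "k \<noteq> 0"
        using True by (intro notI) auto
      then obtain l where l: "k = Suc l"
        using not0_implies_Suc by blast
      then have "norm x < (1/2) ^ l"
        using not_less_Least[of l "\<lambda>k. (1/2::real) ^ k \<le> norm x"] by (simp add: k_def)
      then have "x \<in> An l"
        using k l by (simp add: An_def)
      then have "ennreal (norm x powr g) * indicator (ball 0 1) x \<le> (\<Sum>k\<in>{l}. ennreal (norm x powr g) * indicator (An k) x)"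
        by (auto simp: indicator_def)
      also have "\<dots> \<le> (\<Sum>k. ennreal (norm x powr g) * indicator (An k) x)"
        by (rule sum_le_suminf) auto
      finally show ?thesis .
    qed (auto simp: indicator_def)
  qed
  also have "\<dots> = (\<Sum>k. ennreal (q ^ k) * J)"
    by (subst nn_integral_suminf) (auto simp: An)
  also have "\<dots> = ennreal (\<Sum>k. q ^ k) * J"
    using q by (subst ennreal_suminf_multc) (simp add: suminf_ennreal2 summable_geometric)
  also have "\<dots> < \<infinity>"
    using J by (simp add: ennreal_mult_less_top)
  finally show "I < \<infinity>" .
qed

lemma LINT_norm_powr_ball:
  fixes g :: real
  assumes g: "- real DIM('a::euclidean_space) < g"
  obtains \<sigma> where "0 < \<sigma>"
    and "\<And>R. 0 < R \<Longrightarrow> (LINT x:ball (0::'a) R|lebesgue. norm x powr g) = \<sigma> * R powr (DIM('a) + g)"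
proof
  let ?I = "\<lambda>R. (\<integral>\<^sup>+x. ennreal (norm x powr g) * indicator (ball (0::'a) R) x \<partial>lborel)"
  note I1 = nn_integral_norm_powr_unit_ball[OF g]
  show "0 < enn2real (?I 1)"
    using I1 by (simp add: enn2real_positive_iff)
  fix R :: real assume R: "0 < R"
  have "(LINT x:ball (0::'a) R|lebesgue. norm x powr g)
      = enn2real (\<integral>\<^sup>+x. ennreal (indicator (ball (0::'a) R) x *\<^sub>R norm x powr g) \<partial>lebesgue)"
    unfolding set_lebesgue_integral_def
    by (intro integral_eq_nn_integral measurable_completion) (measurable, auto)
  also have "(\<integral>\<^sup>+x. ennreal (indicator (ball (0::'a) R) x *\<^sub>R norm x powr g) \<partial>lebesgue) = ?I R"
    unfolding nn_integral_completion by (intro nn_integral_cong) (auto simp: indicator_def)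
  also have "?I R = ennreal (R powr (DIM('a) + g)) * ?I 1"
    using R by (intro nn_integral_norm_powr_scale) (auto simp: mult_less_cancel_left2)
  finally show "(LINT x:ball (0::'a) R|lebesgue. norm x powr g) = enn2real (?I 1) * R powr (DIM('a) + g)"
    by (simp add: enn2real_mult)
qed

section \<open>Lebesgue measurable functions up to null sets\<close>

lemma sigma_finite_lebesgue: "sigma_finite_measure (lebesgue :: 'a::euclidean_space measure)"
proof
  obtain \<A> :: "'a set set" where "countable \<A>" "\<A> \<subseteq> sets lborel" "\<Union>\<A> = space lborel" "\<forall>a\<in>\<A>. emeasure lborel a \<noteq> \<infinity>"
    using lborel.sigma_finite_countable by blast
  then show "\<exists>\<A>::'a set set. countable \<A> \<and> \<A> \<subseteq> sets lebesgue \<and> \<Union>\<A> = space lebesgue \<and> (\<forall>a\<in>\<A>. emeasure lebesgue a \<noteq> \<infinity>)"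
    by (intro exI[of _ \<A>]) (auto simp: subset_iff)
qed

lemma lebesgue_borel_representative:
  fixes f :: "'a::euclidean_space \<Rightarrow> 'b::euclidean_space"
  assumes f: "f \<in> borel_measurable lebesgue"
  obtains g where "g \<in> borel_measurable borel" "AE x in lebesgue. f x = g x"
proof -
  have "\<exists>g\<in>borel_measurable lborel. AE x in lborel. f x \<bullet> b = g x" for b
    using f by (intro completion_ex_borel_measurable_real) simp
  then obtain g where g: "\<And>b. g b \<in> borel_measurable lborel" "\<And>b. AE x in lborel. f x \<bullet> b = g b x"
    by metis
  show ?thesis
  proof
    show "(\<lambda>x. \<Sum>b\<in>Basis. g b x *\<^sub>R b) \<in> borel_measurable borel"
      using g(1) by simp
    have "AE x in lborel. \<forall>b\<in>Basis. f x \<bullet> b = g b x"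
      using g(2) by (intro AE_finite_allI) auto
    then have "AE x in lborel. f x = (\<Sum>b\<in>Basis. g b x *\<^sub>R b)"
    proof eventually_elim
      case (elim x)
      have "f x = (\<Sum>b\<in>Basis. (f x \<bullet> b) *\<^sub>R b)"
        by (simp add: euclidean_representation)
      then show ?case
        using elim by simp
    qed
    then show "AE x in lebesgue. f x = (\<Sum>b\<in>Basis. g b x *\<^sub>R b)"
      by (rule AE_completion)
  qed
qed

lemma borel_measurable_lebesgue_cong_AE:
  fixes f g :: "'a::euclidean_space \<Rightarrow> 'b::euclidean_space"
  assumes g: "g \<in> borel_measurable lebesgue" and eq: "AE x in lebesgue. f x = g x"
  shows "f \<in> borel_measurable lebesgue"
proof (rule measurableI)
  fix S :: "'b set" assume S: "S \<in> sets borel"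
  have "AE x in lebesgue. x \<in> g -` S \<longleftrightarrow> x \<in> f -` S"
    using eq by eventually_elim auto
  moreover have "g -` S \<in> sets lebesgue"
    using measurable_sets[OF g S] by simp
  ultimately have "f -` S \<in> sets lebesgue"
    by (rule completion.in_sets_AE) simp
  then show "f -` S \<inter> space lebesgue \<in> sets lebesgue"
    by simp
qed simp

section \<open>Minkowski's integral inequality for variable exponents\<close>

text \<open>
  The nonnegative integral of a function that need not be measurable is its lower integral,
  which is still homogeneous.
\<close>

lemma nn_integral_cmult_le:
  fixes f :: "'a \<Rightarrow> ennreal"
  assumes c: "0 < c"
  shows "(\<integral>\<^sup>+x. ennreal c * f x \<partial>M) \<le> ennreal c * (\<integral>\<^sup>+x. f x \<partial>M)"
  unfolding nn_integral_def[of M "\<lambda>x. ennreal c * f x"]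
proof (rule SUP_least; clarify)
  fix s assume s: "simple_function M s" "s \<le> (\<lambda>x. ennreal c * f x)"
  have [measurable]: "s \<in> borel_measurable M"
    using s(1) by (rule borel_measurable_simple_function)
  have one: "ennreal c * ennreal (1 / c) = 1"
    using c by (simp flip: ennreal_mult)
  have "integral\<^sup>S M s = (\<integral>\<^sup>+x. s x \<partial>M)"
    using s(1) by (rule nn_integral_eq_simple_integral[symmetric])
  also have "\<dots> = (\<integral>\<^sup>+x. ennreal c * (ennreal (1 / c) * s x) \<partial>M)"
    by (simp add: mult.assoc[symmetric] one)
  also have "\<dots> = ennreal c * (\<integral>\<^sup>+x. ennreal (1 / c) * s x \<partial>M)"
    by (rule nn_integral_cmult) measurable
  also have "\<dots> \<le> ennreal c * (\<integral>\<^sup>+x. f x \<partial>M)"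
  proof (intro mult_left_mono nn_integral_mono)
    fix x
    have "ennreal (1 / c) * s x \<le> ennreal (1 / c) * (ennreal c * f x)"
      using s(2) by (intro mult_left_mono) (auto simp: le_fun_def)
    also have "\<dots> = f x"
      using one by (simp add: mult.assoc[symmetric] mult.commute)
    finally show "ennreal (1 / c) * s x \<le> f x" .
  qed simp
  finally show "integral\<^sup>S M s \<le> ennreal c * (\<integral>\<^sup>+x. f x \<partial>M)" .
qed

text \<open>
  A convex function lies above its tangent at \<open>c\<close>; multiplied out so that no term is
  subtracted and both sides can be integrated as nonnegative functions. For \<open>z = h / c\<close> this is Young's inequality \<open>z \<le> z\<^sup>p / p + (1 - 1/p)\<close>.
\<close>

lemma powr_above_tangent:
  fixes c h p :: real
  assumes "0 \<le> c" "0 \<le> h" "1 \<le> p"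
  shows "c powr p + p * c powr (p - 1) * h \<le> h powr p + p * c powr p"
proof (cases "c = 0 \<or> h = 0")
  case True
  then show ?thesis
    using assms mult_right_mono[of 1 p "c powr p"] by auto
next
  case False
  then have pos: "0 < c" "0 < h"
    using assms by auto
  define z where "z = h / c"
  have z: "0 < z" "h = z * c"
    using pos by (auto simp: z_def)
  have "(z powr p) powr (1/p) * 1 powr (1 - 1/p) \<le> (1/p) * z powr p + (1 - 1/p) * 1"
    using assms z by (intro Youngs_inequality_0) auto
  then have "p * z \<le> p * ((1/p) * z powr p + (1 - 1/p))"
    using assms z by (intro mult_left_mono) (auto simp: powr_powr)
  moreover have "p * ((1/p) * z powr p + (1 - 1/p)) = z powr p + p - 1"
    using assms by (simp add: field_simps)
  ultimately have "1 + p * z \<le> z powr p + p"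
    by linarith
  then have "(1 + p * z) * c powr p \<le> (z powr p + p) * c powr p"
    by (intro mult_right_mono) auto
  moreover have e: "p * c powr (p - 1) * h = p * z * c powr p"
    using pos z by (simp add: powr_diff)
  moreover have "h powr p = z powr p * c powr p"
    using pos z by (simp add: powr_mult)
  ultimately show ?thesis
    by (simp only: distrib_right)
qed

text \<open>
  Integrating the tangent inequality at the mean \<open>c\<close> of \<open>h\<close> gives Jensen's inequality. If the
  mean is infinite, its real value is \<open>0\<close> and the inequality is trivial; finiteness of the mean
  is therefore recorded separately.
\<close>

lemma (in prob_space)
  fixes h :: "'a \<Rightarrow> real" and p :: real
  assumes [measurable]: "h \<in> borel_measurable M" and h: "\<And>t. 0 \<le> h t" and p: "1 \<le> p"
  shows nn_integral_finite_of_powr: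
      "(\<integral>\<^sup>+t. ennreal (h t powr p) \<partial>M) < \<infinity> \<Longrightarrow> (\<integral>\<^sup>+t. ennreal (h t) \<partial>M) < \<infinity>"
    and jensen_powr:
      "ennreal (enn2real (\<integral>\<^sup>+t. ennreal (h t) \<partial>M) powr p) \<le> (\<integral>\<^sup>+t. ennreal (h t powr p) \<partial>M)"
proof -
  have "(\<integral>\<^sup>+t. ennreal (h t) \<partial>M) \<le> (\<integral>\<^sup>+t. ennreal (h t powr p) + ennreal p \<partial>M)"
  proof (intro nn_integral_mono)
    fix t
    have "h t \<le> p * h t"
      using h[of t] p mult_right_mono[of 1 p "h t"] by simp
    then have "h t \<le> h t powr p + p"
      using powr_above_tangent[of 1 "h t" p] h[of t] p by simp
    then show "ennreal (h t) \<le> ennreal (h t powr p) + ennreal p"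
      using p by (simp add: ennreal_leI flip: ennreal_plus)
  qed
  also have "\<dots> = (\<integral>\<^sup>+t. ennreal (h t powr p) \<partial>M) + ennreal p"
    by (subst nn_integral_add) (auto simp: emeasure_space_1)
  finally have le: "(\<integral>\<^sup>+t. ennreal (h t) \<partial>M) \<le> (\<integral>\<^sup>+t. ennreal (h t powr p) \<partial>M) + ennreal p" .
  show fin: "(\<integral>\<^sup>+t. ennreal (h t) \<partial>M) < \<infinity>" if "(\<integral>\<^sup>+t. ennreal (h t powr p) \<partial>M) < \<infinity>"
    using le that by (auto simp: less_top[symmetric] top_unique)
  show "ennreal (enn2real (\<integral>\<^sup>+t. ennreal (h t) \<partial>M) powr p) \<le> (\<integral>\<^sup>+t. ennreal (h t powr p) \<partial>M)"
  proof (cases "(\<integral>\<^sup>+t. ennreal (h t powr p) \<partial>M) < \<infinity>")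
    case True
    define c where "c = enn2real (\<integral>\<^sup>+t. ennreal (h t) \<partial>M)"
    have c: "(\<integral>\<^sup>+t. ennreal (h t) \<partial>M) = ennreal c" "0 \<le> c"
      using fin[OF True] by (auto simp: c_def)
    have cc: "c powr (p - 1) * c = c powr p"
      using c by (cases "c = 0") (auto simp: powr_diff)
    have "ennreal (c powr p) + ennreal (p * c powr p)
        = ennreal (c powr p) + ennreal (p * c powr (p - 1)) * ennreal c"
      using p c cc by (simp add: ennreal_mult[symmetric] mult.assoc)
    also have "\<dots> = (\<integral>\<^sup>+t. ennreal (c powr p) + ennreal (p * c powr (p - 1)) * ennreal (h t) \<partial>M)"
      by (subst nn_integral_add) (auto simp: emeasure_space_1 nn_integral_cmult c)
    also have "\<dots> \<le> (\<integral>\<^sup>+t. ennreal (h t powr p) + ennreal (p * c powr p) \<partial>M)"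
    proof (intro nn_integral_mono)
      fix t
      show "ennreal (c powr p) + ennreal (p * c powr (p - 1)) * ennreal (h t)
          \<le> ennreal (h t powr p) + ennreal (p * c powr p)"
        using powr_above_tangent[OF c(2) h[of t] p] p h[of t]
        by (simp add: ennreal_mult[symmetric] ennreal_plus[symmetric] ennreal_leI del: ennreal_plus)
    qed
    also have "\<dots> = (\<integral>\<^sup>+t. ennreal (h t powr p) \<partial>M) + ennreal (p * c powr p)"
      by (subst nn_integral_add) (auto simp: emeasure_space_1)
    finally show ?thesis
      by (simp add: c_def[symmetric] ennreal_add_left_cancel_le add.commute)
  next
    case False
    then have "(\<integral>\<^sup>+t. ennreal (h t powr p) \<partial>M) = \<infinity>"
      by (metis infinity_ennreal_def top.not_eq_extremum)
    then show ?thesis by simp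
  qed
qed

text \<open>
  The hypothesis says that the Luxemburg norm of \<open>K(\<cdot>, t)\<close> is at most \<open>B(t)\<close>, and the
  conclusion that the norm of \<open>\<integral> K(\<cdot>, t) dt\<close> is at most \<open>S\<close>. The bound \<open>B\<close> is an arbitrary
  function. The norm \<open>N\<close> itself is measurable in \<open>t\<close>, since it is an infimum
  over rational numbers, and \<open>\<integral>N \<le> \<integral>B\<close> holds for the lower integral of \<open>B\<close>. Adding a small
  multiple of a positive integrable function to \<open>N\<close> gives a density \<open>M > N\<close> with \<open>\<integral>M \<le> S\<close>; for this
  density the convexity argument applies, because the modular of \<open>K(\<cdot>, t) / M(t)\<close> is at most \<open>1\<close>.
\<close>

lemma (in pair_sigma_finite) minkowski_modular:
  fixes K :: "'a \<times> 'b \<Rightarrow> real" and Q :: "'a \<Rightarrow> real" and B :: "'b \<Rightarrow> ennreal"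
  assumes K [measurable]: "K \<in> borel_measurable (M1 \<Otimes>\<^sub>M M2)" and K0: "\<And>z. 0 \<le> K z"
    and Q [measurable]: "Q \<in> borel_measurable M1" and Q1: "\<And>x. 1 \<le> Q x"
    and bnd: "AE t in M2. \<forall>\<eta>>0. B t \<le> ennreal \<eta> \<longrightarrow>
                (\<integral>\<^sup>+x. ennreal ((K (x, t) / \<eta>) powr Q x) \<partial>M1) \<le> 1"
    and S: "(\<integral>\<^sup>+t. B t \<partial>M2) < ennreal S"
    and nontrivial: "emeasure M2 (space M2) \<noteq> 0"
  shows "AE x in M1. (\<integral>\<^sup>+t. ennreal (K (x, t)) \<partial>M2) < \<infinity>"
    and "(\<integral>\<^sup>+x. ennreal ((enn2real (\<integral>\<^sup>+t. ennreal (K (x, t)) \<partial>M2) / S) powr Q x) \<partial>M1) \<le> 1"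
proof -
  have K' [measurable]: "(\<lambda>p. K (snd p, fst p)) \<in> borel_measurable (M2 \<Otimes>\<^sub>M M1)"
    by measurable
  define md where "md t \<eta> = (\<integral>\<^sup>+x. ennreal ((K (x, t) / \<eta>) powr Q x) \<partial>M1)" for t \<eta>
  have md_meas [measurable]: "(\<lambda>t. md t \<eta>) \<in> borel_measurable M2" for \<eta>
    unfolding md_def by measurable
  have md_mono: "md t \<eta>' \<le> md t \<eta>" if "0 < \<eta>" "\<eta> \<le> \<eta>'" for t \<eta> \<eta>'
    unfolding md_def
  proof (intro nn_integral_mono ennreal_leI powr_mono2)
    fix x show "0 \<le> Q x" using Q1[of x] by simp
    show "0 \<le> K (x, t) / \<eta>'" "K (x, t) / \<eta>' \<le> K (x, t) / \<eta>"
      using that K0[of "(x, t)"] by (auto intro: divide_left_mono)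
  qed
  define N where "N t = (INF r\<in>{r::rat. 0 < r}. if md t (of_rat r) \<le> 1 then ennreal (of_rat r) else \<infinity>)" for t
  have N_meas [measurable]: "N \<in> borel_measurable M2"
    unfolding N_def by (intro borel_measurable_INF) auto
  have N_le: "AE t in M2. N t \<le> B t"
    using bnd
  proof eventually_elim
    case (elim t)
    show ?case
    proof (rule dense_ge)
      fix y assume y: "B t < y"
      show "N t \<le> y"
      proof (cases "y = \<infinity>")
        case False
        then obtain b y' where b: "B t = ennreal b" "0 \<le> b" "y = ennreal y'" "0 \<le> y'"
          using y by (metis ennreal_cases infinity_ennreal_def order_less_trans top.not_eq_extremum)
        then obtain r where r: "b < of_rat r" "of_rat r < y'"
          using y of_rat_dense[of b y'] by (auto simp: ennreal_less_iff)
        then have "0 < r"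
          using b by (metis le_less_trans zero_less_of_rat_iff)
        moreover have "md t (of_rat r) \<le> 1"
          unfolding md_def using elim r b \<open>0 < r\<close> by (auto simp: less_imp_le ennreal_leI)
        ultimately have "N t \<le> ennreal (of_rat r)"
          unfolding N_def by (intro INF_lower2[of r]) auto
        also have "\<dots> \<le> y"
          using b r by (auto intro: ennreal_leI)
        finally show ?thesis .
      qed simp
    qed
  qed
  have md_le: "md t \<eta> \<le> 1" if less: "N t < ennreal \<eta>" for t \<eta>
  proof -
    obtain r :: rat where "0 < r"
        and r': "(if md t (of_rat r) \<le> 1 then ennreal (of_rat r) else \<infinity>) < ennreal \<eta>"
      using less unfolding N_def INF_less_iff by blast
    then have r: "0 < r" "md t (of_rat r) \<le> 1" "ennreal (of_rat r) < ennreal \<eta>"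
      by (auto split: if_splits)
    then have "md t \<eta> \<le> md t (of_rat r)"
      by (intro md_mono) (auto simp: ennreal_less_iff)
    then show ?thesis
      using r by simp
  qed
  have S0: "0 < S"
    using S by (metis ennreal_eq_0_iff not_less not_less_zero)
  have "(\<integral>\<^sup>+t. N t \<partial>M2) \<le> (\<integral>\<^sup>+t. B t \<partial>M2)"
    by (rule nn_integral_mono_AE[OF N_le])
  then have intN: "(\<integral>\<^sup>+t. N t \<partial>M2) < ennreal S"
    using S by simp
  define sN where "sN = enn2real (\<integral>\<^sup>+t. N t \<partial>M2)"
  have sN: "(\<integral>\<^sup>+t. N t \<partial>M2) = ennreal sN" "0 \<le> sN"
    using less_trans[OF intN ennreal_less_top] by (simp_all add: sN_def)
  then have "sN < S"
    using intN by (simp add: ennreal_less_iff)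
  obtain h where [measurable]: "h \<in> borel_measurable M2" and h: "(\<integral>\<^sup>+t. h t \<partial>M2) \<noteq> \<infinity>"
      "\<And>t. t \<in> space M2 \<Longrightarrow> 0 < h t \<and> h t < \<infinity>"
    using M2.Ex_finite_integrable_function by blast
  define sh where "sh = enn2real (\<integral>\<^sup>+t. h t \<partial>M2)"
  have sh: "(\<integral>\<^sup>+t. h t \<partial>M2) = ennreal sh" "0 \<le> sh"
    using h(1) by (simp_all add: sh_def less_top)
  define \<epsilon> where "\<epsilon> = (S - sN) / (sh + 1)"
  have eps: "0 < \<epsilon>" "sN + \<epsilon> * sh \<le> S"
    using \<open>sN < S\<close> sh by (auto simp: \<epsilon>_def field_simps mult_left_mono)
  \<comment> \<open>the added term makes \<open>M\<close> positive and strictly larger than the norm \<open>N\<close>\<close>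
  define M where "M t = N t + ennreal \<epsilon> * h t" for t
  have [measurable]: "M \<in> borel_measurable M2"
    unfolding M_def by measurable
  define s where "s = sN + \<epsilon> * sh"
  have intM: "(\<integral>\<^sup>+t. M t \<partial>M2) = ennreal s"
    unfolding M_def s_def using sN sh eps
    by (subst nn_integral_add) (auto simp: nn_integral_cmult ennreal_mult)
  have s: "0 < s" "s \<le> S"
  proof -
    have "\<not> (AE t in M2. M t = 0)"
    proof
      assume "AE t in M2. M t = 0"
      then have "AE t in M2. False"
        using AE_space
      proof eventually_elim
        case (elim t)
        then show ?case using h(2)[of t] eps by (auto simp: M_def ennreal_eq_0_iff)
      qed
      then show False
        using nontrivial by (auto simp: AE_iff_measurable[OF _ refl])
    qed
    then have "(\<integral>\<^sup>+t. M t \<partial>M2) \<noteq> 0"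
      by (subst nn_integral_0_iff_AE) auto
    then show "0 < s" using intM by (cases "0 < s") (auto simp: ennreal_neg)
    show "s \<le> S" using eps by (simp add: s_def)
  qed
  define m where "m t = enn2real (M t)" for t
  have [measurable]: "m \<in> borel_measurable M2"
    unfolding m_def by measurable
  have "AE t in M2. N t \<noteq> \<infinity>"
    using intN by (intro nn_integral_PInf_AE) auto
  then have AE_m: "AE t in M2. M t = ennreal (m t) \<and> 0 < m t \<and> md t (m t) \<le> 1"
    using AE_space
  proof eventually_elim
    case (elim t)
    then have hN: "N t < \<infinity>" "0 < h t" "h t < \<infinity>"
      using h(2)[of t] by (auto simp: less_top)
    then have fin: "M t < \<infinity>"
      by (simp add: M_def ennreal_mult_less_top)
    have pos: "0 < ennreal \<epsilon> * h t"
      using hN eps by (simp add: ennreal_zero_less_mult_iff)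
    then have NM: "N t < M t"
      using hN pos ennreal_add_left_cancel_less[of "N t" 0 "ennreal \<epsilon> * h t"] by (simp add: M_def less_top)
    have Mm: "M t = ennreal (m t)"
      using fin by (simp add: m_def)
    then have "0 < ennreal (m t)"
      using NM le_less_trans[of 0 "N t" "M t"] by simp
    then show ?case
      using Mm md_le[of t "m t"] NM by simp
  qed
  define \<mu> where "\<mu> = density M2 (\<lambda>t. M t / ennreal s)"
  interpret \<mu>: prob_space \<mu>
  proof
    show "emeasure \<mu> (space \<mu>) = 1"
      using s by (simp add: \<mu>_def emeasure_density nn_integral_divide intM divide_ennreal cong: nn_integral_cong_simp)
  qed
  have nn_\<mu>: "(\<integral>\<^sup>+t. f t \<partial>\<mu>) = (\<integral>\<^sup>+t. M t / ennreal s * f t \<partial>M2)" if "f \<in> borel_measurable M2" for f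
    using that unfolding \<mu>_def by (subst nn_integral_density) auto
  have K_sec [measurable]: "(\<lambda>t. K (x, t)) \<in> borel_measurable M2" if "x \<in> space M1" for x
    using that by measurable
  have jens: "ennreal ((enn2real (\<integral>\<^sup>+t. ennreal (K (x, t)) \<partial>M2) / s) powr Q x)
        \<le> (\<integral>\<^sup>+t. M t / ennreal s * ennreal ((K (x, t) / m t) powr Q x) \<partial>M2)" (is ?A)
    and fin: "(\<integral>\<^sup>+t. M t / ennreal s * ennreal ((K (x, t) / m t) powr Q x) \<partial>M2) < \<infinity>
        \<Longrightarrow> (\<integral>\<^sup>+t. ennreal (K (x, t)) \<partial>M2) < \<infinity>"
    if x: "x \<in> space M1" for x
  proof -
    have [measurable]: "(\<lambda>t. K (x, t)) \<in> borel_measurable M2"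
      using x by (rule K_sec)
    have meas: "(\<lambda>t. K (x, t) / m t) \<in> borel_measurable \<mu>"
      unfolding \<mu>_def by simp
    have nonneg: "0 \<le> K (x, t) / m t" for t
      using K0 by (simp add: m_def)
    have "(\<integral>\<^sup>+t. ennreal (K (x, t) / m t) \<partial>\<mu>) = (\<integral>\<^sup>+t. M t / ennreal s * ennreal (K (x, t) / m t) \<partial>M2)"
      by (rule nn_\<mu>) simp
    also have "\<dots> = (\<integral>\<^sup>+t. ennreal (K (x, t)) / ennreal s \<partial>M2)"
    proof (rule nn_integral_cong_AE)
      show "AE t in M2. M t / ennreal s * ennreal (K (x, t) / m t) = ennreal (K (x, t)) / ennreal s"
        using AE_m
      proof eventually_elim
        case (elim t)
        then show ?case
          using s K0[of "(x, t)"] by (simp add: divide_ennreal ennreal_mult[symmetric])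
      qed
    qed
    also have "\<dots> = (\<integral>\<^sup>+t. ennreal (K (x, t)) \<partial>M2) / ennreal s"
      by (rule nn_integral_divide) simp
    finally have eq: "(\<integral>\<^sup>+t. ennreal (K (x, t) / m t) \<partial>\<mu>) = (\<integral>\<^sup>+t. ennreal (K (x, t)) \<partial>M2) / ennreal s" .
    have eqp: "(\<integral>\<^sup>+t. ennreal ((K (x, t) / m t) powr Q x) \<partial>\<mu>)
        = (\<integral>\<^sup>+t. M t / ennreal s * ennreal ((K (x, t) / m t) powr Q x) \<partial>M2)"
      by (rule nn_\<mu>) simp
    have "enn2real ((\<integral>\<^sup>+t. ennreal (K (x, t)) \<partial>M2) / ennreal s) = enn2real (\<integral>\<^sup>+t. ennreal (K (x, t)) \<partial>M2) / s"
      using s by (simp add: divide_ennreal_def enn2real_mult inverse_ennreal divide_inverse)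
    then show ?A
      using \<mu>.jensen_powr[OF meas nonneg Q1[of x]] by (simp add: eq eqp)
    assume "(\<integral>\<^sup>+t. M t / ennreal s * ennreal ((K (x, t) / m t) powr Q x) \<partial>M2) < \<infinity>"
    then have "(\<integral>\<^sup>+t. ennreal (K (x, t)) \<partial>M2) / ennreal s < \<infinity>"
      using \<mu>.nn_integral_finite_of_powr[OF meas nonneg Q1[of x]] by (simp add: eq eqp)
    then show "(\<integral>\<^sup>+t. ennreal (K (x, t)) \<partial>M2) < \<infinity>"
      using s by (auto simp: less_top[symmetric] ennreal_divide_eq_top_iff)
  qed
  have "(\<integral>\<^sup>+x. \<integral>\<^sup>+t. M t / ennreal s * ennreal ((K (x, t) / m t) powr Q x) \<partial>M2 \<partial>M1)
      = (\<integral>\<^sup>+t. \<integral>\<^sup>+x. M t / ennreal s * ennreal ((K (x, t) / m t) powr Q x) \<partial>M1 \<partial>M2)"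
    by (rule Fubini'[symmetric]) measurable
  also have "\<dots> \<le> (\<integral>\<^sup>+t. M t / ennreal s \<partial>M2)"
  proof (rule nn_integral_mono_AE)
    show "AE t in M2. (\<integral>\<^sup>+x. M t / ennreal s * ennreal ((K (x, t) / m t) powr Q x) \<partial>M1) \<le> M t / ennreal s"
      using AE_m AE_space
    proof eventually_elim
      case (elim t)
      then have [measurable]: "t \<in> space M2" by simp
      have "(\<integral>\<^sup>+x. M t / ennreal s * ennreal ((K (x, t) / m t) powr Q x) \<partial>M1) = M t / ennreal s * md t (m t)"
        unfolding md_def by (rule nn_integral_cmult) measurable
      also have "\<dots> \<le> M t / ennreal s * 1"
        using elim by (intro mult_left_mono) auto
      finally show ?case by simp
    qed
  qed
  also have "\<dots> = 1"
    using s by (simp add: nn_integral_divide intM divide_ennreal)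
  finally have main: "(\<integral>\<^sup>+x. \<integral>\<^sup>+t. M t / ennreal s * ennreal ((K (x, t) / m t) powr Q x) \<partial>M2 \<partial>M1) \<le> 1" .
  have "AE x in M1. (\<integral>\<^sup>+t. M t / ennreal s * ennreal ((K (x, t) / m t) powr Q x) \<partial>M2) \<noteq> \<infinity>"
    using main by (intro nn_integral_PInf_AE) (auto simp: top_unique)
  then show "AE x in M1. (\<integral>\<^sup>+t. ennreal (K (x, t)) \<partial>M2) < \<infinity>"
    using AE_space
  proof eventually_elim
    case (elim x)
    then show ?case
      using fin[of x] by (simp add: less_top)
  qed
  have "(\<integral>\<^sup>+x. ennreal ((enn2real (\<integral>\<^sup>+t. ennreal (K (x, t)) \<partial>M2) / S) powr Q x) \<partial>M1)
      \<le> (\<integral>\<^sup>+x. \<integral>\<^sup>+t. M t / ennreal s * ennreal ((K (x, t) / m t) powr Q x) \<partial>M2 \<partial>M1)"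
  proof (rule nn_integral_mono)
    fix x assume x: "x \<in> space M1"
    have "(enn2real (\<integral>\<^sup>+t. ennreal (K (x, t)) \<partial>M2) / S) powr Q x
        \<le> (enn2real (\<integral>\<^sup>+t. ennreal (K (x, t)) \<partial>M2) / s) powr Q x"
      using s Q1[of x] by (intro powr_mono2 divide_left_mono) auto
    then show "ennreal ((enn2real (\<integral>\<^sup>+t. ennreal (K (x, t)) \<partial>M2) / S) powr Q x)
        \<le> (\<integral>\<^sup>+t. M t / ennreal s * ennreal ((K (x, t) / m t) powr Q x) \<partial>M2)"
      using jens[OF x] by (meson ennreal_leI order_trans)
  qed
  then show "(\<integral>\<^sup>+x. ennreal ((enn2real (\<integral>\<^sup>+t. ennreal (K (x, t)) \<partial>M2) / S) powr Q x) \<partial>M1) \<le> 1"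
    using main by simp
qed

section \<open>Hoelder inequalities for variable exponents\<close>

text \<open>
  A cheap form of the weighted arithmetic-geometric mean inequality: each factor is at most the
  corresponding power of the sum. Both Hoelder inequalities
  below rest on it.
\<close>

lemma prod_powr_le_sum:
  fixes u \<theta> :: "'i::finite \<Rightarrow> real"
  assumes u: "\<And>i. 0 \<le> u i" and \<theta>: "\<And>i. 0 \<le> \<theta> i" and sum: "(\<Sum>i\<in>UNIV. \<theta> i) = 1"
  shows "(\<Prod>i\<in>UNIV. u i powr \<theta> i) \<le> (\<Sum>i\<in>UNIV. u i)"
proof (cases "(\<Sum>i\<in>UNIV. u i) = 0")
  case True
  then have "u i = 0" for i
    using u by (simp add: sum_nonneg_eq_0_iff)
  then show ?thesis by (simp add: power_0_left)
next
  case False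
  have "(\<Prod>i\<in>UNIV. u i powr \<theta> i) \<le> (\<Prod>i\<in>UNIV. (\<Sum>j\<in>UNIV. u j) powr \<theta> i)"
    using u \<theta> by (intro prod_mono conjI powr_mono2 member_le_sum) auto
  also have "\<dots> = (\<Sum>j\<in>UNIV. u j)"
    using sum_nonneg[of UNIV u] u by (simp add: powr_sum[OF False, symmetric] sum)
  finally show ?thesis .
qed

text \<open>
  Hoelder's inequality for several variable exponents, for modulars. Pointwise,
  \<open>(\<Prod>k\<^sub>i)\<^sup>Q \<le> \<Sum> k\<^sub>i\<close> to the powers \<open>P\<^sub>i\<close>. The integral of the sum is at most \<open>2m\<close>, and dividing the
  product by \<open>2m \<ge> 1\<close> divides its modular by at least \<open>2m\<close> because \<open>Q \<ge> 1\<close>.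
\<close>

lemma modular_prod_le:
  fixes k :: "'i::finite \<Rightarrow> 'a \<Rightarrow> real" and P :: "'i \<Rightarrow> 'a \<Rightarrow> real" and Q :: "'a \<Rightarrow> real"
  assumes [measurable]: "\<And>i. k i \<in> borel_measurable M" "\<And>i. P i \<in> borel_measurable M" "Q \<in> borel_measurable M"
    and k: "\<And>i x. 0 \<le> k i x" and P: "\<And>i x. 1 \<le> P i x" and Q: "\<And>x. 1 \<le> Q x"
    and sum: "\<And>x. (\<Sum>i\<in>UNIV. 1 / P i x) = 1 / Q x"
    and bnd: "\<And>i. (\<integral>\<^sup>+x. ennreal (k i x powr P i x) \<partial>M) \<le> 2"
  shows "(\<integral>\<^sup>+x. ennreal (((\<Prod>i\<in>UNIV. k i x) / (2 * CARD('i))) powr Q x) \<partial>M) \<le> 1"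
proof -
  define c where "c = 2 * real CARD('i)"
  have "1 \<le> CARD('i)"
    by (simp add: Suc_le_eq)
  then have c: "1 \<le> c"
    unfolding c_def by linarith
  have pw: "((\<Prod>i\<in>UNIV. k i x) / c) powr Q x \<le> (\<Sum>i\<in>UNIV. k i x powr P i x) / c" for x
  proof -
    have Px: "0 < P i x" for i using P[of i x] by simp
    have Qx: "1 \<le> Q x" by (rule Q)
    have "(\<Prod>i\<in>UNIV. k i x) powr Q x = (\<Prod>i\<in>UNIV. (k i x powr P i x) powr (Q x / P i x))"
      using Px by (simp add: prod_powr_distrib k powr_powr less_imp_neq[THEN not_sym])
    also have "\<dots> \<le> (\<Sum>i\<in>UNIV. k i x powr P i x)"
    proof (rule prod_powr_le_sum)
      have "(\<Sum>i\<in>UNIV. Q x / P i x) = Q x * (\<Sum>i\<in>UNIV. 1 / P i x)"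
        by (simp add: sum_distrib_left)
      then show "(\<Sum>i\<in>UNIV. Q x / P i x) = 1"
        using Qx by (simp add: sum)
      show "0 \<le> Q x / P i x" for i
        using Px[of i] Qx by simp
    qed simp
    finally have 1: "(\<Prod>i\<in>UNIV. k i x) powr Q x \<le> (\<Sum>i\<in>UNIV. k i x powr P i x)" .
    have "c powr 1 \<le> c powr Q x"
      using c Qx by (intro powr_mono) auto
    then have 2: "c \<le> c powr Q x"
      using c by simp
    have "((\<Prod>i\<in>UNIV. k i x) / c) powr Q x = (\<Prod>i\<in>UNIV. k i x) powr Q x / c powr Q x"
      using c k by (simp add: powr_divide prod_nonneg)
    also have "\<dots> \<le> (\<Sum>i\<in>UNIV. k i x powr P i x) / c"
      using 1 2 c by (intro frac_le) (auto intro: sum_nonneg)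
    finally show ?thesis .
  qed
  have "(\<integral>\<^sup>+x. ennreal (((\<Prod>i\<in>UNIV. k i x) / c) powr Q x) \<partial>M)
      \<le> (\<integral>\<^sup>+x. (\<Sum>i\<in>UNIV. ennreal (k i x powr P i x)) / ennreal c \<partial>M)"
  proof (rule nn_integral_mono)
    fix x
    show "ennreal (((\<Prod>i\<in>UNIV. k i x) / c) powr Q x) \<le> (\<Sum>i\<in>UNIV. ennreal (k i x powr P i x)) / ennreal c"
      using c pw[of x] by (simp add: divide_ennreal sum_nonneg ennreal_leI)
  qed
  also have "\<dots> = (\<Sum>i\<in>UNIV. \<integral>\<^sup>+x. ennreal (k i x powr P i x) \<partial>M) / ennreal c"
    by (subst nn_integral_divide, measurable, subst nn_integral_sum) auto
  also have "\<dots> \<le> (\<Sum>i\<in>(UNIV::'i set). ennreal 2) / ennreal c"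
    using bnd by (intro divide_right_mono_ennreal sum_mono) simp
  also have "(\<Sum>i\<in>(UNIV::'i set). ennreal 2) = ennreal c"
    by (simp add: c_def ennreal_mult ennreal_of_nat_eq_real_of_nat mult.commute)
  also have "ennreal c / ennreal c = 1"
    using c by (simp add: divide_ennreal)
  finally show ?thesis by (simp add: c_def)
qed

lemma modular_finite_exponent:
  assumes "\<And>x. p x \<noteq> \<infinity>"
  shows "modular p g = (\<integral>\<^sup>+x. ennreal (norm (g x) powr enn2real (p x)) \<partial>lebesgue)"
proof -
  have "{x. p x = \<infinity>} = {}"
    using assms by auto
  moreover have "esssup (restrict_space lebesgue {}) (\<lambda>x::'a. ennreal (norm (g x))) \<le> 0"
    by (rule esssup_I) (auto simp: measurable_def space_restrict_space AE_restrict_space_iff)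
  ultimately show ?thesis
    by (simp add: modular_def)
qed

lemma modular_le_one_of_Lp_norm_less:
  assumes fin: "\<And>x. q x \<noteq> \<infinity>" and less: "Lp_norm q g < ennreal b"
  shows "(\<integral>\<^sup>+x. ennreal ((norm (g x) / b) powr enn2real (q x)) \<partial>lebesgue) \<le> 1"
proof -
  obtain \<eta> :: real where \<eta>: "0 < \<eta>" "modular q (\<lambda>x. g x / of_real \<eta>) \<le> 1" "ennreal \<eta> < ennreal b"
    using less unfolding Lp_norm_def INF_less_iff by blast
  then have "\<eta> < b"
    by (simp add: ennreal_less_iff)
  have "(\<integral>\<^sup>+x. ennreal ((norm (g x) / b) powr enn2real (q x)) \<partial>lebesgue)
      \<le> (\<integral>\<^sup>+x. ennreal ((norm (g x) / \<eta>) powr enn2real (q x)) \<partial>lebesgue)"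
    using \<eta>(1) \<open>\<eta> < b\<close> by (intro nn_integral_mono ennreal_leI powr_mono2 divide_left_mono) auto
  also have "\<dots> = modular q (\<lambda>x. g x / of_real \<eta>)"
    using \<eta>(1) by (simp add: modular_finite_exponent[OF fin] norm_divide)
  finally show ?thesis
    using \<eta>(2) by simp
qed

text \<open>
  The whole space has infinite measure. If \<open>\<eta> < 1\<close> were admissible, the integral part of the
  modular would force \<open>{r \<noteq> \<infinity>}\<close> to have measure at most \<open>1\<close>; then \<open>{r = \<infinity>}\<close> is not null and the
  essential supremum part equals \<open>1/\<eta> > 1\<close>.
\<close>

lemma one_le_Lp_norm_one:
  assumes [measurable]: "r \<in> borel_measurable (lebesgue :: 'a::euclidean_space measure)"
  shows "1 \<le> Lp_norm r (\<lambda>_. 1)"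
  unfolding Lp_norm_def
proof (rule INF_greatest; clarify)
  fix \<eta> :: real assume \<eta>: "0 < \<eta>" and m: "modular r (\<lambda>x. 1 / of_real \<eta>) \<le> 1"
  let ?I = "{x. r x = \<infinity>}"
  have [measurable]: "?I \<in> sets lebesgue"
    using measurable_sets[OF assms, of "{\<infinity>}"] by (simp add: vimage_def)
  then have I' [measurable]: "- ?I \<in> sets lebesgue"
    using sets.compl_sets[of ?I lebesgue] by (simp add: Compl_eq_Diff_UNIV)
  have nrm: "norm (1 / complex_of_real \<eta>) = 1 / \<eta>"
    using \<eta> by (simp add: norm_divide)
  show "1 \<le> ennreal \<eta>"
  proof (rule ccontr)
    assume "\<not> 1 \<le> ennreal \<eta>"
    then have \<eta>1: "\<eta> < 1"
      by (metis ennreal_1 ennreal_leI not_le_imp_less)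
    have "emeasure lebesgue (- ?I) = (\<integral>\<^sup>+x\<in>- ?I. 1 \<partial>lebesgue)"
      using I' by simp
    also have "\<dots> \<le> (\<integral>\<^sup>+x\<in>- ?I. ennreal ((1 / \<eta>) powr enn2real (r x)) \<partial>lebesgue)"
    proof (intro nn_integral_mono mult_right_mono)
      fix x
      have "1 \<le> (1 / \<eta>) powr enn2real (r x)"
        using \<eta> \<eta>1 by (intro ge_one_powr_ge_zero) auto
      then show "1 \<le> ennreal ((1 / \<eta>) powr enn2real (r x))"
        by simp
    qed simp
    also have "\<dots> \<le> modular r (\<lambda>x. 1 / of_real \<eta>)"
      unfolding modular_def nrm by simp
    finally have "emeasure lebesgue (- ?I) \<le> 1"
      using m by simp
    moreover have "emeasure lebesgue (- ?I) + emeasure lebesgue ?I = emeasure lebesgue (- ?I \<union> ?I)"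
      by (rule plus_emeasure) (use \<open>?I \<in> sets lebesgue\<close> I' in auto)
    then have "emeasure lebesgue (- ?I) + emeasure lebesgue ?I = \<infinity>"
      by (simp add: Compl_partition2)
    ultimately have "emeasure lebesgue ?I \<noteq> 0"
      by (auto simp: top_unique)
    then have "esssup (restrict_space lebesgue ?I) (\<lambda>x. ennreal (1 / \<eta>)) = ennreal (1 / \<eta>)"
      using \<open>?I \<in> sets lebesgue\<close>
      by (intro esssup_const) (simp add: emeasure_restrict_space space_restrict_space)
    then have "ennreal (1 / \<eta>) \<le> modular r (\<lambda>x. 1 / of_real \<eta>)"
      unfolding modular_def nrm by simp
    then have "ennreal (1 / \<eta>) \<le> 1"
      using m by (rule order_trans)
    then show False
      using \<eta> \<eta>1 by simp
  qed
qed

text \<open>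
  Since the norm is positive and finite, twice the norm is strictly larger than the infimum that defines it.
\<close>

lemma Lp_norm_one_witness:
  assumes "r \<in> borel_measurable (lebesgue :: 'a::euclidean_space measure)" and "Lp_norm r (\<lambda>_. 1) < \<infinity>"
  obtains k :: real where "0 < k" "ennreal k \<le> 2 * Lp_norm r (\<lambda>_. 1)" "modular r (\<lambda>x. 1 / of_real k) \<le> 1"
proof -
  define L where "L = enn2real (Lp_norm r (\<lambda>_. 1))"
  have L: "Lp_norm r (\<lambda>_. 1) = ennreal L"
    using assms by (simp add: L_def)
  then have "1 \<le> L"
    using one_le_Lp_norm_one[OF assms(1)] by simp
  then have "Lp_norm r (\<lambda>_. 1) < 2 * Lp_norm r (\<lambda>_. 1)"
    unfolding L by (metis L_def ennreal_less_iff ennreal_mult ennreal_numeral enn2real_nonneg less_add_same_cancel1 less_le_trans mult_2 zero_le_numeral zero_less_one)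
  then show ?thesis
    using that unfolding Lp_norm_def[of r] INF_less_iff by (auto intro: less_imp_le)
qed

text \<open>
  The embedding of \<open>L\<^sup>q\<close> into \<open>L\<^sup>s\<close> for \<open>s \<le> q\<close>, by Hoelder's inequality with
  \<open>1/s = 1/q + 1/r\<close> applied to \<open>g \<cdot> 1\<close>. Where \<open>s = q\<close> the exponent \<open>r\<close> is infinite, and the essential supremum
  in the modular of \<open>r\<close> gives \<open>1/k \<le> 1\<close> almost everywhere there.
\<close>

lemma modular_embedding:
  fixes g s q :: "'a::euclidean_space \<Rightarrow> real" and r :: "'a \<Rightarrow> ennreal"
  assumes [measurable]: "g \<in> borel_measurable lebesgue" "s \<in> borel_measurable lebesgue" "q \<in> borel_measurable lebesgue"
    and g: "\<And>x. 0 \<le> g x" and s: "\<And>x. 1 \<le> s x" and sq: "\<And>x. s x \<le> q x"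
    and r: "\<And>x. r x = 1 / ennreal (1 / s x - 1 / q x)"
    and k: "0 < k" "modular r (\<lambda>x. 1 / of_real k) \<le> 1"
    and bnd: "(\<integral>\<^sup>+x. ennreal (g x powr q x) \<partial>lebesgue) \<le> 1"
  shows "(\<integral>\<^sup>+x. ennreal ((g x / k) powr s x) \<partial>lebesgue) \<le> 2"
proof -
  let ?I = "{x. r x = \<infinity>}"
  have [measurable]: "r \<in> borel_measurable lebesgue"
    unfolding r[abs_def] by measurable
  have I [measurable]: "?I \<in> sets lebesgue"
    using measurable_sets[of r lebesgue borel "{\<infinity>}"] by (simp add: vimage_def)
  then have I' [measurable]: "- ?I \<in> sets lebesgue"
    using sets.compl_sets[of ?I lebesgue] by (simp add: Compl_eq_Diff_UNIV)
  have nrm: "norm (1 / complex_of_real k) = 1 / k"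
    using k by (simp add: norm_divide)
  have m: "(\<integral>\<^sup>+x\<in>- ?I. ennreal ((1 / k) powr enn2real (r x)) \<partial>lebesgue) \<le> 1"
      "esssup (restrict_space lebesgue ?I) (\<lambda>x. ennreal (1 / k)) \<le> 1"
    using k(2) unfolding modular_def nrm by (auto intro: order_trans[rotated])
  have "AE x in restrict_space lebesgue ?I. ennreal (1 / k) \<le> 1"
    using esssup_AE[of "\<lambda>x. ennreal (1 / k)" "restrict_space lebesgue ?I"]
    by eventually_elim (rule order_trans[OF _ m(2)])
  then have ae: "AE x in lebesgue. r x = \<infinity> \<longrightarrow> ennreal (1 / k) \<le> 1"
    using I by (subst (asm) AE_restrict_space_iff) auto
  have "(\<integral>\<^sup>+x. ennreal ((g x / k) powr s x) \<partial>lebesgue)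
      \<le> (\<integral>\<^sup>+x. ennreal (g x powr q x) + ennreal ((1 / k) powr enn2real (r x)) * indicator (- ?I) x \<partial>lebesgue)"
  proof (rule nn_integral_mono_AE)
    show "AE x in lebesgue. ennreal ((g x / k) powr s x)
        \<le> ennreal (g x powr q x) + ennreal ((1 / k) powr enn2real (r x)) * indicator (- ?I) x"
      using ae
    proof eventually_elim
      case (elim x)
      have sx: "0 < s x" "0 < q x" and gx: "0 \<le> g x"
        using s[of x] sq[of x] g[of x] by auto
      show ?case
      proof (cases "s x = q x")
        case True
        then have "r x = \<infinity>"
          by (simp add: r ennreal_divide_zero)
        then have "1 / k \<le> 1"
          using elim by simp
        then have "g x / k \<le> g x"
          using gx mult_left_mono[of "1 / k" 1 "g x"] by simp
        then have "(g x / k) powr s x \<le> g x powr q x"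
          using True sx gx k by (auto intro: powr_mono2)
        then show ?thesis
          by (simp add: add_increasing2 ennreal_leI)
      next
        case False
        then have d: "0 < 1 / s x - 1 / q x"
          using sq[of x] sx by (simp add: field_simps)
        define R where "R = 1 / (1 / s x - 1 / q x)"
        have R: "0 < R" "r x = ennreal R"
          using d by (auto simp: R_def r divide_ennreal[of 1, simplified])
        have "(g x powr q x) powr (s x / q x) * ((1 / k) powr R) powr (s x / R) = (g x / k) powr s x"
          using sx R gx k by (simp add: powr_powr powr_mult[symmetric])
        moreover have "s x / q x + s x / R = 1"
          using sx by (simp add: R_def field_simps)
        ultimately have "(g x / k) powr s x \<le> g x powr q x + (1 / k) powr R"
          using prod_powr_le_sum[of "\<lambda>b. if b then g x powr q x else (1 / k) powr R" "\<lambda>b. if b then s x / q x else s x / R"]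
            sx R by (simp add: UNIV_bool add.commute mult.commute)
        then show ?thesis
          using R by (simp add: ennreal_leI flip: ennreal_plus)
      qed
    qed
  qed
  also have "\<dots> = (\<integral>\<^sup>+x. ennreal (g x powr q x) \<partial>lebesgue)
      + (\<integral>\<^sup>+x\<in>- ?I. ennreal ((1 / k) powr enn2real (r x)) \<partial>lebesgue)"
    by (rule nn_integral_add) auto
  also have "\<dots> \<le> 1 + 1"
    using bnd m by (intro add_mono)
  finally show ?thesis by simp
qed

section \<open>Bounded exponents and their limits at infinity\<close>

lemma exponents_bD:
  assumes "q \<in> exponents_b"
  shows exponents_b_measurable: "q \<in> borel_measurable lebesgue"
    and exponents_b_finite: "q x \<noteq> \<infinity>"
    and exponents_b_ennreal: "ennreal (enn2real (q x)) = q x"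
    and exponents_b_ge_1: "1 \<le> enn2real (q x)"
    and exponents_b_rcp_bounds: "rcp (ess_sup q) \<le> 1 / enn2real (q x)" "1 / enn2real (q x) \<le> rcp (ess_inf q)"
proof -
  have q: "q \<in> exponents" "1 < ess_inf q" "ess_inf q \<le> q x" "q x \<le> ess_sup q" "ess_sup q < \<infinity>"
    using assms by (auto simp: exponents_b_def)
  show "q \<in> borel_measurable lebesgue"
    using q(1) by (simp add: exponents_def)
  show fin: "q x \<noteq> \<infinity>"
    using q(4,5) by (metis infinity_ennreal_def top.extremum_strict top_unique)
  then show eq: "ennreal (enn2real (q x)) = q x"
    by (simp add: less_top)
  have inf: "ess_inf q < \<infinity>"
    using q(3) fin by (metis infinity_ennreal_def less_top top_unique)
  have e: "rcp r = 1 / enn2real r" if "1 \<le> r" "r < \<infinity>" for r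
  proof -
    have "r = ennreal (enn2real r)" "1 \<le> enn2real r"
      using that by (simp_all, metis enn2real_leI enn2real_mono enn2real_1 infinity_ennreal_def)
    then show ?thesis
      unfolding rcp_def by (metis divide_ennreal enn2real_ennreal ennreal_1 less_le_trans zero_le_divide_1_iff zero_le_one zero_less_one order.trans)
  qed
  have ge: "1 \<le> enn2real (ess_inf q)" "enn2real (ess_inf q) \<le> enn2real (q x)" "enn2real (q x) \<le> enn2real (ess_sup q)"
    using q(2-5) inf fin enn2real_mono[of 1 "ess_inf q"] enn2real_mono[of "ess_inf q" "q x"] enn2real_mono[of "q x" "ess_sup q"]
    by (auto simp: less_imp_le less_top)
  then show "1 \<le> enn2real (q x)" by simp
  show "rcp (ess_sup q) \<le> 1 / enn2real (q x)"
    using e[of "ess_sup q"] q ge by (auto simp: divide_left_mono intro!: frac_le)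
  show "1 / enn2real (q x) \<le> rcp (ess_inf q)"
    using e[of "ess_inf q"] q ge inf by (auto intro!: frac_le)
qed

lemma r_exp_eq:
  assumes "q \<in> exponents_b"
  shows "r_exp q A x = 1 / ennreal (1 / enn2real (q (matrix_inv A *v x)) - 1 / enn2real (q x))"
proof -
  have "1 / q y = ennreal (1 / enn2real (q y))" for y
    using exponents_b_ge_1[OF assms, of y]
    by (subst exponents_b_ennreal[OF assms, symmetric], subst divide_ennreal[of 1, simplified]) auto
  then show ?thesis
    unfolding r_exp_def by (simp add: ennreal_minus)
qed

lemma r_exp_measurable:
  assumes q: "q \<in> exponents_b" and A: "invertible A"
  shows "r_exp q A \<in> borel_measurable lebesgue"
proof -
  have qm [measurable]: "q \<in> borel_measurable lebesgue"
    by (rule exponents_b_measurable[OF q])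
  have [measurable]: "(\<lambda>x. q (matrix_inv A *v x)) \<in> borel_measurable lebesgue"
    using measurable_compose[OF invertible_measurable_lebesgue[OF invertible_matrix_inv(3)[OF A]] qm] .
  show ?thesis
    unfolding r_exp_eq[OF q, abs_def] by measurable
qed

lemma exponents_inf_limit:
  fixes q :: "'a::euclidean_space \<Rightarrow> ennreal"
  assumes "q \<in> exponents_inf"
  shows "(q \<longlongrightarrow> q_infty q) at_infinity" and "1 \<le> q_infty q"
proof -
  show lim: "(q \<longlongrightarrow> q_infty q) at_infinity"
    using assms unfolding exponents_inf_def q_infty_def
    by (auto dest: tendsto_Lim[OF trivial_limit_at_infinity])
  show "1 \<le> q_infty q"
    using assms by (intro tendsto_lowerbound[OF lim _ trivial_limit_at_infinity] always_eventually) (auto simp: exponents_inf_def exponents_def)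
qed

lemma ennreal_reciprocal_finite:
  fixes c :: ennreal
  assumes "1 \<le> c"
  shows "1 / c < \<infinity>"
proof -
  have "1 / c \<noteq> \<infinity>"
    using assms by (auto simp: ennreal_divide_eq_top_iff)
  then show ?thesis
    by (simp add: less_top)
qed

text \<open>
  The limit inherits the finite upper bound of the exponent.
\<close>

lemma rcp_q_infty_pos:
  fixes q :: "'a::euclidean_space \<Rightarrow> ennreal"
  assumes b: "q \<in> exponents_b" and i: "q \<in> exponents_inf"
  shows "0 < rcp (q_infty q)"
proof -
  have "q_infty q \<le> ess_sup q"
    using b by (intro tendsto_upperbound[OF exponents_inf_limit(1)[OF i] _ trivial_limit_at_infinity] always_eventually) (auto simp: exponents_b_def)
  then have "q_infty q < \<infinity>"
    using b by (auto simp: exponents_b_def)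
  then show ?thesis
    using ennreal_reciprocal_finite[OF exponents_inf_limit(2)[OF i]] unfolding rcp_def
    by (auto simp: enn2real_positive_iff zero_less_iff_neq_zero)
qed

lemma sum_rcp_q_infty:
  fixes qs :: "'m::finite \<Rightarrow> 'a::euclidean_space \<Rightarrow> ennreal"
  assumes qs: "\<And>i. qs i \<in> exponents_inf" and q: "q \<in> exponents_inf"
    and sum: "\<And>x. (\<Sum>i\<in>UNIV. 1 / qs i x) = 1 / q x"
  shows "(\<Sum>i\<in>UNIV. rcp (q_infty (qs i))) = rcp (q_infty q)"
proof -
  have inv: "((\<lambda>x. 1 / p x) \<longlongrightarrow> 1 / q_infty p) at_infinity" if "p \<in> exponents_inf" for p :: "'a \<Rightarrow> ennreal"
  proof -
    have "continuous_on UNIV (\<lambda>x::ennreal. inverse x)"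
      by (intro continuous_intros)
    from continuous_on_tendsto_compose[OF this exponents_inf_limit(1)[OF that]] show ?thesis
      by (simp add: divide_ennreal_def)
  qed
  have "((\<lambda>x. \<Sum>i\<in>UNIV. 1 / qs i x) \<longlongrightarrow> (\<Sum>i\<in>UNIV. 1 / q_infty (qs i))) at_infinity"
    by (intro tendsto_sum inv qs)
  moreover have "((\<lambda>x. \<Sum>i\<in>UNIV. 1 / qs i x) \<longlongrightarrow> 1 / q_infty q) at_infinity"
    unfolding sum by (rule inv[OF q])
  ultimately have eq: "(\<Sum>i\<in>UNIV. 1 / q_infty (qs i)) = 1 / q_infty q"
    by (rule tendsto_unique[OF trivial_limit_at_infinity])
  have "1 / q_infty (qs i) < top" for i
    using ennreal_reciprocal_finite[OF exponents_inf_limit(2)[OF qs[of i]]] by simp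
  then show ?thesis
    unfolding rcp_def eq[symmetric] by (simp add: enn2real_sum)
qed

lemma sum_reciprocal_exponents:
  fixes qs :: "'m::finite \<Rightarrow> 'a::euclidean_space \<Rightarrow> ennreal"
  assumes qs: "\<And>i. qs i \<in> exponents_b" and q: "q \<in> exponents"
    and sum: "(\<Sum>i\<in>UNIV. 1 / qs i x) = 1 / q x"
  shows "q x \<noteq> \<infinity>" and "(\<Sum>i\<in>UNIV. 1 / enn2real (qs i x)) = 1 / enn2real (q x)"
proof -
  have e: "1 / r = ennreal (1 / enn2real r)" if "1 \<le> r" "r \<noteq> \<infinity>" for r
  proof -
    obtain s where s: "r = ennreal s" "0 \<le> s"
      using \<open>r \<noteq> \<infinity>\<close> by (cases r) auto
    then have "1 \<le> s"
      using that by simp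
    then show ?thesis
      using s divide_ennreal[of 1 s] by simp
  qed
  have qsi: "1 \<le> qs i x" "qs i x \<noteq> \<infinity>" for i
    using qs[of i] exponents_b_finite[OF qs[of i]] by (auto simp: exponents_b_def exponents_def)
  have "1 / q x = (\<Sum>i\<in>UNIV. ennreal (1 / enn2real (qs i x)))"
    unfolding sum[symmetric] by (intro sum.cong refl e qsi)
  also have "\<dots> = ennreal (\<Sum>i\<in>UNIV. 1 / enn2real (qs i x))"
    by (rule sum_ennreal) simp
  finally have eq: "1 / q x = ennreal (\<Sum>i\<in>UNIV. 1 / enn2real (qs i x))" .
  have "0 < (\<Sum>i\<in>UNIV. 1 / enn2real (qs i x))"
  proof (intro sum_pos)
    fix i show "0 < 1 / enn2real (qs i x)"
      using exponents_b_ge_1[OF qs, of i x] by simp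
  qed auto
  then show fin: "q x \<noteq> \<infinity>"
    using eq by (intro notI) (simp add: ennreal_eq_0_iff)
  have "1 \<le> q x"
    using q by (simp add: exponents_def)
  from e[OF this fin] show "(\<Sum>i\<in>UNIV. 1 / enn2real (qs i x)) = 1 / enn2real (q x)"
    using eq by (subst (asm) eq) (simp add: ennreal_inj sum_nonneg)
qed

section \<open>The integrand for a fixed value of the integration variable\<close>

text \<open>
  For \<open>\<alpha> \<ge> 0\<close> this is \<open>|A\<inverse>y| \<le> \<parallel>A\<inverse>\<parallel> |y|\<close>, and for \<open>\<alpha> < 0\<close> it is
  \<open>|y| \<le> \<parallel>A\<parallel> |A\<inverse>y|\<close>. For \<open>y = 0\<close> both sides vanish, as \<open>0 powr \<alpha> = 0\<close>.
\<close>

lemma norm_inverse_powr_le: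
  fixes A :: "real^'n^'n"
  assumes A: "invertible A"
  shows "norm (matrix_inv A *v y) powr \<alpha> \<le> max (norm A powr (- \<alpha>)) (norm (matrix_inv A) powr \<alpha>) * norm y powr \<alpha>"
proof (cases "y = 0")
  case False
  let ?B = "matrix_inv A"
  have AB: "A *v (?B *v y) = y"
    using invertible_matrix_inv[OF A] by (simp add: matrix_vector_mul_assoc)
  have up: "norm (?B *v y) \<le> norm ?B * norm y" and low: "norm y \<le> norm A * norm (?B *v y)"
    using norm_matrix_vector_mult_le[of ?B y] norm_matrix_vector_mult_le[of A "?B *v y"] AB by auto
  have "A \<noteq> 0"
    using AB False by auto
  show ?thesis
  proof (cases "0 \<le> \<alpha>")
    case True
    then have "norm (?B *v y) powr \<alpha> \<le> (norm ?B * norm y) powr \<alpha>"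
      using up by (intro powr_mono2) auto
    also have "\<dots> = norm ?B powr \<alpha> * norm y powr \<alpha>"
      by (simp add: powr_mult)
    also have "\<dots> \<le> max (norm A powr (- \<alpha>)) (norm ?B powr \<alpha>) * norm y powr \<alpha>"
      by (intro mult_right_mono) auto
    finally show ?thesis .
  next
    case neg: False
    have "norm y / norm A \<le> norm (?B *v y)"
      using low \<open>A \<noteq> 0\<close> by (simp add: field_simps)
    moreover have "0 < norm y / norm A"
      using False \<open>A \<noteq> 0\<close> by simp
    ultimately have "norm (?B *v y) powr \<alpha> \<le> (norm y / norm A) powr \<alpha>"
      using neg by (intro powr_mono2') auto
    also have "\<dots> = norm A powr (- \<alpha>) * norm y powr \<alpha>"
      by (simp add: powr_divide powr_minus field_simps)
    also have "\<dots> \<le> max (norm A powr (- \<alpha>)) (norm ?B powr \<alpha>) * norm y powr \<alpha>"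
      by (intro mult_right_mono) auto
    finally show ?thesis .
  qed
qed simp

text \<open>
  Substituting \<open>x = A\<inverse>y\<close> produces the Jacobian \<open>b = |det A\<inverse>|\<close>. The second factor of
  \<^const>\<open>c_const\<close> is at least \<open>b\<close> to the power \<open>1/q\<close> for every value of the exponent, so dividing by it
  absorbs \<open>b\<close>; the first factor absorbs the change of the power weight. What is left is
  an integral with exponent \<open>q(A\<inverse>y) \<le> q(y)\<close>, which \<open>modular_embedding\<close> controls.
\<close>

lemma modular_dilation:
  fixes A :: "real^'n^'n" and f :: "real^'n \<Rightarrow> complex"
  assumes q: "q \<in> exponents_b" and A: "invertible A"
    and le: "\<And>x. q (matrix_inv A *v x) \<le> q x"
    and k: "0 < k" "modular (r_exp q A) (\<lambda>x. 1 / of_real k) \<le> 1"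
    and f [measurable]: "f \<in> borel_measurable lebesgue" and N: "0 < N"
    and bnd: "(\<integral>\<^sup>+y. ennreal ((norm (f y) * norm y powr \<alpha> * indicator (ball 0 (norm A * R)) y / N)
                 powr enn2real (q y)) \<partial>lebesgue) \<le> 1"
  shows "0 < c_const A q \<alpha>"
    and "(\<integral>\<^sup>+x. ennreal ((norm (f (A *v x)) * norm x powr \<alpha> * indicator (ball 0 R) x / (c_const A q \<alpha> * k * N))
           powr enn2real (q x)) \<partial>lebesgue) \<le> 2"
proof -
  let ?B = "matrix_inv A"
  note inv = invertible_matrix_inv[OF A]
  have AB: "A *v (?B *v y) = y" for y
    using inv by (simp add: matrix_vector_mul_assoc)
  have qm [measurable]: "q \<in> borel_measurable lebesgue"
    by (rule exponents_b_measurable[OF q])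
  have Am [measurable]: "(\<lambda>x. A *v x) \<in> lebesgue \<rightarrow>\<^sub>M lebesgue" and Bm [measurable]: "(\<lambda>x. ?B *v x) \<in> lebesgue \<rightarrow>\<^sub>M lebesgue"
    by (rule invertible_measurable_lebesgue[OF A], rule invertible_measurable_lebesgue[OF inv(3)])
  have [measurable]: "(\<lambda>x. f (A *v x)) \<in> borel_measurable lebesgue" "(\<lambda>x. q (?B *v x)) \<in> borel_measurable lebesgue"
    using measurable_compose[OF Am f] measurable_compose[OF Bm qm] by auto
  have [measurable]: "(\<lambda>x::real^'n. norm x powr \<alpha>) \<in> borel_measurable lebesgue"
    by (intro measurable_completion) simp
  have [measurable]: "ball (0::real^'n) r \<in> sets lebesgue" for r
    by simp
  define c1 where "c1 = max (norm A powr (- \<alpha>)) (norm ?B powr \<alpha>)"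
  define b where "b = \<bar>det ?B\<bar>"
  define c2 where "c2 = max (b powr rcp (ess_sup q)) (b powr rcp (ess_inf q))"
  have c_const: "c_const A q \<alpha> = c1 * c2"
    by (simp add: c_const_def c1_def c2_def b_def)
  have "A \<noteq> 0"
    by (rule invertible_imp_nonzero[OF A])
  then have c1: "0 < c1"
    by (simp add: c1_def less_max_iff_disj)
  have "det ?B \<noteq> 0"
    using inv(3) invertible_det_nz by blast
  then have b: "0 < b"
    by (simp add: b_def)
  then have c2: "0 < c2"
    by (simp add: c2_def less_max_iff_disj)
  show "0 < c_const A q \<alpha>"
    using c1 c2 by (simp add: c_const)
  define Q where "Q x = enn2real (q x)" for x
  have Q1: "1 \<le> Q x" for x
    unfolding Q_def by (rule exponents_b_ge_1[OF q])
  have [measurable]: "Q \<in> borel_measurable lebesgue" "(\<lambda>x. Q (?B *v x)) \<in> borel_measurable lebesgue"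
    unfolding Q_def[abs_def] by measurable
  have Qle: "Q (?B *v x) \<le> Q x" for x
    unfolding Q_def using le[of x] exponents_b_finite[OF q, of x] by (intro enn2real_mono) (auto simp: less_top)
  \<comment> \<open>\<open>1/Q\<close> lies between \<open>1/q\<^sub>+\<close> and \<open>1/q\<^sub>-\<close>; which endpoint dominates depends on whether \<open>b \<ge> 1\<close>\<close>
  have b_le: "b \<le> c2 powr Q y" for y
  proof -
    have "b powr (1 / Q y) \<le> c2"
    proof (cases "1 \<le> b")
      case True
      then have "b powr (1 / Q y) \<le> b powr rcp (ess_inf q)"
        unfolding Q_def by (intro powr_mono exponents_b_rcp_bounds[OF q])
      then show ?thesis by (simp add: c2_def)
    next
      case False
      then have "b powr (1 / Q y) \<le> b powr rcp (ess_sup q)"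
        unfolding Q_def using b by (intro powr_mono' exponents_b_rcp_bounds[OF q]) auto
      then show ?thesis by (simp add: c2_def)
    qed
    then have "(b powr (1 / Q y)) powr Q y \<le> c2 powr Q y"
      using Q1[of y] by (intro powr_mono2) auto
    then show ?thesis
      using b Q1[of y] by (simp add: powr_powr)
  qed
  define g where "g y = norm (f y) * norm y powr \<alpha> * indicator (ball 0 (norm A * R)) y / N" for y
  have [measurable]: "g \<in> borel_measurable lebesgue"
    unfolding g_def[abs_def] by measurable
  have g0: "0 \<le> g y" for y
    using N by (simp add: g_def)
  define h where "h x = norm (f (A *v x)) * norm x powr \<alpha> * indicator (ball 0 R) x / (c_const A q \<alpha> * k * N)" for x
  have [measurable]: "h \<in> borel_measurable lebesgue"
    unfolding h_def[abs_def] by measurable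
  have h0: "0 \<le> h x" for x
    using N k c1 c2 by (simp add: h_def c_const)
  have hB: "h (?B *v y) \<le> (g y / k) / c2" for y
  proof -
    have ind: "indicator (ball 0 R) (?B *v y) \<le> (indicator (ball 0 (norm A * R)) y :: real)"
    proof (cases "norm (?B *v y) < R")
      case True
      have "norm y \<le> norm A * norm (?B *v y)"
        using norm_matrix_vector_mult_le[of A "?B *v y"] AB by simp
      also have "\<dots> < norm A * R"
        using True \<open>A \<noteq> 0\<close> by simp
      finally show ?thesis
        using True by (simp add: indicator_def)
    qed (simp add: indicator_def)
    have "norm (?B *v y) powr \<alpha> * indicator (ball 0 R) (?B *v y)
        \<le> (c1 * norm y powr \<alpha>) * indicator (ball 0 (norm A * R)) y"
      using ind norm_inverse_powr_le[OF A, of y \<alpha>] c1 by (intro mult_mono) (auto simp: c1_def)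
    then have "norm (f y) * (norm (?B *v y) powr \<alpha> * indicator (ball 0 R) (?B *v y)) / (c1 * c2 * k * N)
        \<le> norm (f y) * ((c1 * norm y powr \<alpha>) * indicator (ball 0 (norm A * R)) y) / (c1 * c2 * k * N)"
      using c1 c2 k N by (intro divide_right_mono mult_left_mono) auto
    then show ?thesis
      using c1 c2 k N by (simp add: h_def g_def AB c_const field_simps)
  qed
  have "(\<integral>\<^sup>+x. ennreal (h x powr Q x) \<partial>lebesgue) = ennreal b * (\<integral>\<^sup>+y. ennreal (h (?B *v y) powr Q (?B *v y)) \<partial>lebesgue)"
    unfolding b_def by (rule nn_integral_lebesgue_invertible[OF inv(3)]) measurable
  also have "\<dots> \<le> ennreal b * (\<integral>\<^sup>+y. ennreal (((g y / k) / c2) powr Q (?B *v y)) \<partial>lebesgue)"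
  proof (intro mult_left_mono nn_integral_mono ennreal_leI powr_mono2 hB h0)
    show "0 \<le> Q (?B *v y)" for y using Q1[of "?B *v y"] by simp
  qed simp
  also have "\<dots> = (\<integral>\<^sup>+y. ennreal b * ennreal (((g y / k) / c2) powr Q (?B *v y)) \<partial>lebesgue)"
    by (rule nn_integral_cmult[symmetric]) measurable
  also have "\<dots> \<le> (\<integral>\<^sup>+y. ennreal ((g y / k) powr Q (?B *v y)) \<partial>lebesgue)"
  proof (rule nn_integral_mono)
    fix y
    have "b * ((g y / k) / c2) powr Q (?B *v y) = (g y / k) powr Q (?B *v y) * (b / c2 powr Q (?B *v y))"
      using c2 g0[of y] k by (simp add: powr_divide powr_mult)
    also have "\<dots> \<le> (g y / k) powr Q (?B *v y) * 1"
      using b_le[of "?B *v y"] c2 by (intro mult_left_mono) auto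
    finally show "ennreal b * ennreal (((g y / k) / c2) powr Q (?B *v y)) \<le> ennreal ((g y / k) powr Q (?B *v y))"
      using b by (simp add: ennreal_leI flip: ennreal_mult)
  qed
  also have "\<dots> \<le> 2"
  proof (rule modular_embedding[where q = Q and r = "r_exp q A"])
    show "r_exp q A x = 1 / ennreal (1 / Q (?B *v x) - 1 / Q x)" for x
      unfolding Q_def by (rule r_exp_eq[OF q])
    show "(\<integral>\<^sup>+x. ennreal (g x powr Q x) \<partial>lebesgue) \<le> 1"
      using bnd by (simp add: g_def Q_def)
  qed (use g0 Q1 Qle k in auto)
  finally show "(\<integral>\<^sup>+x. ennreal ((norm (f (A *v x)) * norm x powr \<alpha> * indicator (ball 0 R) x / (c_const A q \<alpha> * k * N))
           powr enn2real (q x)) \<partial>lebesgue) \<le> 2"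
    by (simp add: h_def Q_def)
qed

text \<open>
  For one value of \<open>t\<close>: \<open>M i\<close> stands for \<open>A\<^sub>i(t)\<close> and \<open>w\<close> for \<open>\<Phi>(t) / |t|\<^sup>n\<close>, and
  \<open>a i * \<rho> powr \<kappa> i\<close> is the bound for the weighted norm of \<open>f i\<close> on the ball of radius \<open>\<rho>\<close>
  that the Morrey norm supplies. The factors are dilated one by one with \<open>modular_dilation\<close> and
  multiplied with \<open>modular_prod_le\<close>; the factor \<open>2\<close> in front of \<open>a i\<close> comes from
  \<open>Lp_norm_one_witness\<close>.
\<close>

lemma kernel_modular_le:
  fixes M :: "'m::finite \<Rightarrow> real^'n^'n" and f :: "'m \<Rightarrow> real^'n \<Rightarrow> complex"
    and qs :: "'m \<Rightarrow> real^'n \<Rightarrow> ennreal" and Q :: "real^'n \<Rightarrow> real"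
  assumes qs: "\<And>i. qs i \<in> exponents_b"
    and Q [measurable]: "Q \<in> borel_measurable lebesgue" and Q1: "\<And>x. 1 \<le> Q x"
    and sum: "\<And>x. (\<Sum>i\<in>UNIV. 1 / enn2real (qs i x)) = 1 / Q x"
    and M: "\<And>i. invertible (M i)"
    and le: "\<And>i x. qs i (matrix_inv (M i) *v x) \<le> qs i x"
    and Lp: "\<And>i. Lp_norm (r_exp (qs i) (M i)) (\<lambda>_. 1) < \<infinity>"
    and f [measurable]: "\<And>i. f i \<in> borel_measurable lebesgue"
    and a: "\<And>i. 0 < a i"
    and bnd: "\<And>i \<rho>. 0 < \<rho> \<Longrightarrow> (\<integral>\<^sup>+y. ennreal ((norm (f i y) * norm y powr \<alpha>s i * indicator (ball 0 \<rho>) y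
                 / (a i * \<rho> powr \<kappa> i)) powr enn2real (qs i y)) \<partial>lebesgue) \<le> 1"
    and R: "0 < R" and w: "0 \<le> w" and \<eta>: "0 < \<eta>"
    and le_\<eta>: "ennreal (2 * CARD('m) * (\<Prod>i\<in>UNIV. 2 * (a i * R powr \<kappa> i))) *
          (ennreal w * (\<Prod>i\<in>UNIV. ennreal (norm (M i) powr \<kappa> i * c_const (M i) (qs i) (\<alpha>s i))
               * Lp_norm (r_exp (qs i) (M i)) (\<lambda>_. 1))) \<le> ennreal \<eta>"
  shows "(\<integral>\<^sup>+x. ennreal ((w * (\<Prod>i\<in>UNIV. norm (f i (M i *v x))) * norm x powr (\<Sum>i\<in>UNIV. \<alpha>s i) * indicator (ball 0 R) x / \<eta>)
            powr Q x) \<partial>lebesgue) \<le> 1"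
proof -
  let ?L = "\<lambda>i. Lp_norm (r_exp (qs i) (M i)) (\<lambda>_. 1)"
  have "\<exists>k. 0 < k \<and> ennreal k \<le> 2 * ?L i \<and> modular (r_exp (qs i) (M i)) (\<lambda>x. 1 / of_real k) \<le> 1" for i
    using Lp_norm_one_witness[OF r_exp_measurable[OF qs M] Lp] by metis
  then obtain k where k: "\<And>i. 0 < k i" "\<And>i. ennreal (k i) \<le> 2 * ?L i"
      "\<And>i. modular (r_exp (qs i) (M i)) (\<lambda>x. 1 / of_real (k i)) \<le> 1"
    by metis
  have Mpos: "0 < norm (M i)" for i
    using invertible_imp_nonzero[OF M, of i] by simp
  define N where "N i = a i * (norm (M i) * R) powr \<kappa> i" for i
  have N: "0 < N i" for i
    unfolding N_def using a[of i] Mpos[of i] R by simp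
  define c where "c i = c_const (M i) (qs i) (\<alpha>s i)" for i
  define h where "h i x = norm (f i (M i *v x)) * norm x powr \<alpha>s i * indicator (ball 0 R) x / (c i * k i * N i)" for i x
  have c: "0 < c i" and hi: "(\<integral>\<^sup>+x. ennreal (h i x powr enn2real (qs i x)) \<partial>lebesgue) \<le> 2" for i
    unfolding c_def h_def
    using modular_dilation[OF qs[of i] M[of i] le k(1)[of i] k(3)[of i] f[of i] N[of i], where \<alpha> = "\<alpha>s i" and R = R]
      bnd[of "norm (M i) * R" i] Mpos[of i] R
    by (simp_all add: N_def)
  have fM [measurable]: "(\<lambda>x. f i (M i *v x)) \<in> borel_measurable lebesgue" for i
    using measurable_compose[OF invertible_measurable_lebesgue[OF M] f] .
  have [measurable]: "(\<lambda>x::real^'n. norm x powr b) \<in> borel_measurable lebesgue" for b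
    by (intro measurable_completion) simp
  have [measurable]: "ball (0::real^'n) r \<in> sets lebesgue" for r
    by simp
  have [measurable]: "h i \<in> borel_measurable lebesgue" for i
    unfolding h_def[abs_def] by measurable
  have [measurable]: "qs i \<in> borel_measurable lebesgue" for i
    by (rule exponents_b_measurable[OF qs])
  have h0: "0 \<le> h i x" for i x
    unfolding h_def using c[of i] k(1)[of i] N[of i] by simp
  define d where "d = (\<Prod>i\<in>UNIV. c i * k i * N i)"
  have d: "0 < d"
    unfolding d_def using c k N by (intro prod_pos) auto
  have prod_k: "(\<integral>\<^sup>+x. ennreal (((\<Prod>i\<in>UNIV. h i x) / (2 * CARD('m))) powr Q x) \<partial>lebesgue) \<le> 1"
    by (rule modular_prod_le[where P = "\<lambda>i x. enn2real (qs i x)"])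
      (use h0 Q1 sum hi exponents_b_ge_1[OF qs] in auto)
  have "ennreal (2 * CARD('m) * w * d) \<le> ennreal \<eta>"
  proof -
    have "ennreal d = (\<Prod>i\<in>UNIV. ennreal (c i * k i * N i))"
      unfolding d_def using c k N by (intro prod_ennreal[symmetric]) (auto simp: less_imp_le)
    also have "\<dots> = (\<Prod>i\<in>UNIV. ennreal (c i * N i) * ennreal (k i))"
    proof (rule prod.cong[OF refl])
      fix i
      have "c i * k i * N i = (c i * N i) * k i" by simp
      then show "ennreal (c i * k i * N i) = ennreal (c i * N i) * ennreal (k i)"
        using c[of i] k(1)[of i] N[of i] by (simp only: ennreal_mult less_imp_le mult_nonneg_nonneg)
    qed
    finally have "ennreal (2 * CARD('m) * w * d)
        = ennreal (2 * CARD('m)) * (ennreal w * (\<Prod>i\<in>UNIV. ennreal (c i * N i) * ennreal (k i)))"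
      using w d by (simp only: ennreal_mult mult.assoc less_imp_le mult_nonneg_nonneg of_nat_0_le_iff zero_le_numeral)
    also have "\<dots> \<le> ennreal (2 * CARD('m)) * (ennreal w * (\<Prod>i\<in>UNIV. ennreal (c i * N i) * (2 * ?L i)))"
      by (intro mult_left_mono prod_mono_ennreal k(2)) auto
    also have "\<dots> = ennreal (2 * CARD('m)) * (ennreal w * (\<Prod>i\<in>UNIV. ennreal (2 * (a i * R powr \<kappa> i)) *
        (ennreal (norm (M i) powr \<kappa> i * c i) * ?L i)))"
    proof -
      have "ennreal (c i * N i) * (2 * ?L i) = ennreal (2 * (a i * R powr \<kappa> i)) * (ennreal (norm (M i) powr \<kappa> i * c i) * ?L i)" for i
      proof -
        have e: "2 * (c i * N i) = (2 * (a i * R powr \<kappa> i)) * (norm (M i) powr \<kappa> i * c i)"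
          by (simp add: N_def powr_mult)
        have "ennreal (c i * N i) * (2 * ?L i) = ennreal (2 * (c i * N i)) * ?L i"
          using c[of i] N[of i] by (simp add: ennreal_mult mult_ac)
        also have "\<dots> = ennreal (2 * (a i * R powr \<kappa> i)) * ennreal (norm (M i) powr \<kappa> i * c i) * ?L i"
          unfolding e using a[of i] c[of i] by (subst ennreal_mult) auto
        finally show ?thesis by (simp add: mult.assoc)
      qed
      then show ?thesis by simp
    qed
    also have "\<dots> = ennreal (2 * CARD('m) * (\<Prod>i\<in>UNIV. 2 * (a i * R powr \<kappa> i))) *
          (ennreal w * (\<Prod>i\<in>UNIV. ennreal (norm (M i) powr \<kappa> i * c i) * ?L i))"
    proof -
      have u: "0 \<le> 2 * (a i * R powr \<kappa> i)" for i
        using a[of i] by simp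
      have "ennreal (2 * CARD('m) * (\<Prod>i\<in>UNIV. 2 * (a i * R powr \<kappa> i)))
          = ennreal (2 * CARD('m)) * (\<Prod>i\<in>UNIV. ennreal (2 * (a i * R powr \<kappa> i)))"
        using u by (subst ennreal_mult) (auto intro!: prod_nonneg simp: prod_ennreal)
      then show ?thesis
        by (simp only: prod.distrib mult_ac)
    qed
    also have "\<dots> \<le> ennreal \<eta>"
      using le_\<eta> by (simp add: c_def)
    finally show ?thesis .
  qed
  then have wd: "2 * CARD('m) * w * d \<le> \<eta>"
    using \<eta> by (simp add: ennreal_le_iff)
  have pw: "w * (\<Prod>i\<in>UNIV. norm (f i (M i *v x))) * norm x powr (\<Sum>i\<in>UNIV. \<alpha>s i) * indicator (ball 0 R) x / \<eta>
      \<le> (\<Prod>i\<in>UNIV. h i x) / (2 * CARD('m))" for x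
  proof (cases "x \<noteq> 0 \<and> norm x < R")
    case True
    define p where "p = (\<Prod>i\<in>UNIV. norm (f i (M i *v x)) * norm x powr \<alpha>s i)"
    have "norm x powr (\<Sum>i\<in>UNIV. \<alpha>s i) = (\<Prod>i\<in>UNIV. norm x powr \<alpha>s i)"
      using True by (intro powr_sum) auto
    then have 1: "w * (\<Prod>i\<in>UNIV. norm (f i (M i *v x))) * norm x powr (\<Sum>i\<in>UNIV. \<alpha>s i) * indicator (ball 0 R) x / \<eta> = w * p / \<eta>"
      using True by (simp add: p_def prod.distrib)
    have 2: "(\<Prod>i\<in>UNIV. h i x) = p / d"
      unfolding h_def p_def d_def using True by (simp add: prod_dividef)
    have "w * p * (2 * CARD('m) * d) \<le> p * \<eta>"
      using mult_left_mono[OF wd, of p] by (simp add: p_def prod_nonneg mult_ac)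
    then show ?thesis
      unfolding 1 2 using \<eta> d by (simp add: field_simps)
  next
    case False
    then have "norm x powr (\<Sum>i\<in>UNIV. \<alpha>s i) = 0 \<or> indicator (ball 0 R) x = (0::real)"
      by (auto simp: indicator_def)
    then have z: "w * (\<Prod>i\<in>UNIV. norm (f i (M i *v x))) * norm x powr (\<Sum>i\<in>UNIV. \<alpha>s i) * indicator (ball 0 R) x / \<eta> = 0"
      by auto
    show ?thesis
      unfolding z using h0 by (simp add: prod_nonneg)
  qed
  have "(\<integral>\<^sup>+x. ennreal ((w * (\<Prod>i\<in>UNIV. norm (f i (M i *v x))) * norm x powr (\<Sum>i\<in>UNIV. \<alpha>s i) * indicator (ball 0 R) x / \<eta>)
            powr Q x) \<partial>lebesgue) \<le> (\<integral>\<^sup>+x. ennreal (((\<Prod>i\<in>UNIV. h i x) / (2 * CARD('m))) powr Q x) \<partial>lebesgue)"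
  proof (intro nn_integral_mono ennreal_leI powr_mono2 pw)
    fix x
    show "0 \<le> Q x" using Q1[of x] by simp
    show "0 \<le> w * (\<Prod>i\<in>UNIV. norm (f i (M i *v x))) * norm x powr (\<Sum>i\<in>UNIV. \<alpha>s i) * indicator (ball 0 R) x / \<eta>"
      using w \<eta> by (simp add: prod_nonneg)
  qed
  then show ?thesis
    using prod_k by simp
qed

section \<open>The multilinear Hausdorff operator on balls\<close>

text \<open>
  The representative is built from Borel versions of \<open>\<Phi>\<close>, \<open>A\<^sub>i\<close> and \<open>f\<^sub>i\<close>. For almost every \<open>t\<close> with
  \<open>\<Phi>(t) \<noteq> 0\<close> the matrix \<open>A\<^sub>i(t)\<close> is invertible and so pulls the Borel null set \<open>N\<^sub>i\<close>, off which
  \<open>f\<^sub>i\<close> equals its Borel version, back to a null set. The exceptional set of pairs is thereby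
  contained in a Borel set whose slices are null for almost every \<open>t\<close>, and Tonelli's theorem exchanges the order of the variables.
\<close>

lemma hausdorff_integrand_representative:
  fixes \<Phi> :: "real^'n \<Rightarrow> real" and A :: "'m::finite \<Rightarrow> real^'n \<Rightarrow> real^'n^'n" and f :: "'m \<Rightarrow> real^'n \<Rightarrow> complex"
  assumes \<Phi>: "\<Phi> \<in> borel_measurable lebesgue" and A: "\<And>i. A i \<in> borel_measurable lebesgue"
    and inv: "AE t in lebesgue. \<Phi> t \<noteq> 0 \<longrightarrow> (\<forall>i. invertible (A i t))"
    and f: "\<And>i. f i \<in> borel_measurable lebesgue"
  obtains F where "F \<in> borel_measurable (lebesgue \<Otimes>\<^sub>M lebesgue)"
    and "AE x in lebesgue. AE t in lebesgue. hausdorff_integrand \<Phi> A f x t = F (x, t)"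
    and "AE t in lebesgue. AE x in lebesgue. hausdorff_integrand \<Phi> A f x t = F (x, t)"
proof -
  interpret L: sigma_finite_measure "lebesgue :: (real^'n) measure"
    by (rule sigma_finite_lebesgue)
  interpret P: pair_sigma_finite "lebesgue :: (real^'n) measure" "lebesgue :: (real^'n) measure"
    by standard
  obtain \<Psi> where \<Psi> [measurable]: "\<Psi> \<in> borel_measurable borel" and \<Phi>\<Psi>: "AE t in lebesgue. \<Phi> t = \<Psi> t"
    using lebesgue_borel_representative[OF \<Phi>] by blast
  have "\<forall>i. \<exists>B. B \<in> borel_measurable borel \<and> (AE t in lebesgue. A i t = B t)"
    using lebesgue_borel_representative[OF A] by metis
  then obtain B where B [measurable]: "\<And>i. B i \<in> borel_measurable borel" and AB: "\<And>i. AE t in lebesgue. A i t = B i t"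
    by metis
  have "\<forall>i. \<exists>g. g \<in> borel_measurable borel \<and> (AE t in lebesgue. f i t = g t)"
    using lebesgue_borel_representative[OF f] by metis
  then obtain g where g [measurable]: "\<And>i. g i \<in> borel_measurable borel" and fg: "\<And>i. AE x in lebesgue. f i x = g i x"
    by metis
  have "AE x in lborel. f i x = g i x" for i
    using fg[of i] by (simp only: AE_completion_iff)
  then have "\<forall>i. \<exists>N. N \<in> null_sets lborel \<and> {x. f i x \<noteq> g i x} \<subseteq> N"
    unfolding eventually_ae_filter by auto
  then obtain N where N: "\<And>i. N i \<in> null_sets lborel" and fgN: "\<And>i x. x \<notin> N i \<Longrightarrow> f i x = g i x"
    by (metis (mono_tags, lifting) mem_Collect_eq subsetD)
  have [measurable]: "N i \<in> sets borel" for i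
    using N[of i] by (auto simp: null_sets_def)
  define good where "good t \<longleftrightarrow> \<Phi> t = \<Psi> t \<and> (\<forall>i. A i t = B i t) \<and> (\<Phi> t \<noteq> 0 \<longrightarrow> (\<forall>i. invertible (A i t)))" for t
  have "AE t in lebesgue. \<forall>i. A i t = B i t"
    using AB by (simp add: AE_all_countable)
  then have good: "AE t in lebesgue. good t"
    using \<Phi>\<Psi> inv by eventually_elim (simp add: good_def)
  define F where "F = (\<lambda>(x, t). hausdorff_integrand \<Psi> B g x t)"
  have id [measurable]: "(\<lambda>x::real^'n. x) \<in> borel_measurable lebesgue"
    by (intro measurable_completion) simp
  have m1 [measurable]: "fst \<in> borel_measurable ((lebesgue :: (real^'n) measure) \<Otimes>\<^sub>M (lebesgue :: (real^'n) measure))"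
    using measurable_compose[OF measurable_fst id] by simp
  have m2 [measurable]: "snd \<in> borel_measurable ((lebesgue :: (real^'n) measure) \<Otimes>\<^sub>M (lebesgue :: (real^'n) measure))"
    using measurable_compose[OF measurable_snd id] by simp
  have [measurable]: "F \<in> borel_measurable (lebesgue \<Otimes>\<^sub>M lebesgue)"
    unfolding F_def hausdorff_integrand_def case_prod_beta
    using m1 m2 by measurable
  define P where "P x t \<longleftrightarrow> (\<Psi> t \<noteq> 0 \<longrightarrow> (\<forall>i. B i t *v x \<notin> N i))" for x t
  have eqP: "hausdorff_integrand \<Phi> A f x t = F (x, t)" if "good t" "P x t" for x t
  proof (cases "\<Psi> t = 0")
    case False
    then have "f i (A i t *v x) = g i (B i t *v x)" for i
      using that fgN by (simp add: good_def P_def)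
    then show ?thesis
      using that by (simp add: F_def hausdorff_integrand_def good_def)
  qed (use that in \<open>simp add: F_def hausdorff_integrand_def good_def\<close>)
  have AE1: "AE t in lebesgue. AE x in lebesgue. P x t"
    using good
  proof eventually_elim
    case (elim t)
    show ?case
    proof (cases "\<Psi> t = 0")
      case False
      have "AE x in lebesgue. B i t *v x \<notin> N i" for i
      proof (rule AE_lebesgue_invertible[where P = "\<lambda>y. y \<notin> N i"])
        show "invertible (B i t)"
          using elim False by (auto simp: good_def)
        show "AE y in lebesgue. y \<notin> N i"
          using AE_not_in[OF N[of i]] by (rule AE_completion)
      qed
      then show ?thesis
        unfolding P_def by (simp add: AE_all_countable)
    qed (simp add: P_def)
  qed
  have "{z \<in> space (lebesgue \<Otimes>\<^sub>M lebesgue). P (fst z) (snd z)} \<in> sets (lebesgue \<Otimes>\<^sub>M lebesgue)"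
    unfolding P_def using m1 m2 by measurable
  then have AE2: "AE x in lebesgue. AE t in lebesgue. P x t"
    using P.AE_commute AE1 by blast
  show ?thesis
  proof
    show "AE x in lebesgue. AE t in lebesgue. hausdorff_integrand \<Phi> A f x t = F (x, t)"
      using AE2
    proof eventually_elim
      case (elim x)
      show ?case
        using elim good by eventually_elim (rule eqP)
    qed
    show "AE t in lebesgue. AE x in lebesgue. hausdorff_integrand \<Phi> A f x t = F (x, t)"
      using AE1 good
    proof eventually_elim
      case (elim t)
      show ?case
        using elim(1) by eventually_elim (rule eqP[OF elim(2)])
    qed
  qed fact
qed

text \<open>
  Combines \<open>kernel_modular_le\<close> for almost every \<open>t\<close> with \<open>minkowski_modular\<close>.
  The first conclusion is the absolute convergence of the operator's integral on the ball, the weight being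
  positive away from the origin.
\<close>

lemma hausdorff_Lp_norm_ball_le:
  fixes \<Phi> :: "real^'n \<Rightarrow> real" and A :: "'m::finite \<Rightarrow> real^'n \<Rightarrow> real^'n^'n" and f :: "'m \<Rightarrow> real^'n \<Rightarrow> complex"
    and F :: "(real^'n) \<times> (real^'n) \<Rightarrow> complex"
    and q :: "real^'n \<Rightarrow> ennreal" and qs :: "'m \<Rightarrow> real^'n \<Rightarrow> ennreal"
  assumes \<Phi>0: "\<And>t. 0 \<le> \<Phi> t"
    and inv: "AE t in lebesgue. \<Phi> t \<noteq> 0 \<longrightarrow> (\<forall>i. invertible (A i t))"
    and f [measurable]: "\<And>i. f i \<in> borel_measurable lebesgue"
    and F [measurable]: "F \<in> borel_measurable (lebesgue \<Otimes>\<^sub>M lebesgue)"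
    and F1: "AE x in lebesgue. AE t in lebesgue. hausdorff_integrand \<Phi> A f x t = F (x, t)"
    and F2: "AE t in lebesgue. AE x in lebesgue. hausdorff_integrand \<Phi> A f x t = F (x, t)"
    and H: "AE x in lebesgue. hausdorff \<Phi> A f x = (\<integral>t. F (x, t) \<partial>lebesgue)"
    and qs: "\<And>i. qs i \<in> exponents_b"
    and q: "q \<in> exponents" "\<And>x. q x \<noteq> \<infinity>"
    and sum: "\<And>x. (\<Sum>i\<in>UNIV. 1 / enn2real (qs i x)) = 1 / enn2real (q x)"
    and le: "AE t in lebesgue. \<Phi> t \<noteq> 0 \<longrightarrow>
           (\<forall>i. (\<forall>x. qs i (matrix_inv (A i t) *v x) \<le> qs i x) \<and>
                Lp_norm (r_exp (qs i) (A i t)) (\<lambda>_. 1) < \<infinity>)"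
    and a: "\<And>i. 0 < a i"
    and bnd: "\<And>i \<rho>. 0 < \<rho> \<Longrightarrow> (\<integral>\<^sup>+y. ennreal ((norm (f i y) * norm y powr \<alpha>s i * indicator (ball 0 \<rho>) y
                 / (a i * \<rho> powr \<kappa> i)) powr enn2real (qs i y)) \<partial>lebesgue) \<le> 1"
    and R: "0 < R"
    and S: "ennreal (2 * CARD('m) * (\<Prod>i\<in>UNIV. 2 * (a i * R powr \<kappa> i))) *
        (\<integral>\<^sup>+t. ennreal (\<Phi> t / norm t ^ CARD('n)) * (\<Prod>i\<in>UNIV.
           ennreal (norm (A i t) powr \<kappa> i * c_const (A i t) (qs i) (\<alpha>s i)) *
           Lp_norm (r_exp (qs i) (A i t)) (\<lambda>_. 1)) \<partial>lebesgue) < ennreal S"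
  shows "AE x in lebesgue. (\<integral>\<^sup>+t. ennreal (norm (F (x, t)) * norm x powr (\<Sum>i\<in>UNIV. \<alpha>s i) * indicator (ball 0 R) x) \<partial>lebesgue) < \<infinity>"
    and "Lp_norm q (\<lambda>x. hausdorff \<Phi> A f x * indicator (ball 0 R) x * of_real (norm x powr (\<Sum>i\<in>UNIV. \<alpha>s i))) \<le> ennreal S"
proof -
  interpret L: sigma_finite_measure "lebesgue :: (real^'n) measure"
    by (rule sigma_finite_lebesgue)
  interpret P: pair_sigma_finite "lebesgue :: (real^'n) measure" "lebesgue :: (real^'n) measure"
    by standard
  define \<alpha> where "\<alpha> = (\<Sum>i\<in>UNIV. \<alpha>s i)"
  define Q where "Q x = enn2real (q x)" for x
  have Qm [measurable]: "Q \<in> borel_measurable lebesgue"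
  proof -
    have [measurable]: "q \<in> borel_measurable lebesgue"
      using q(1) by (simp add: exponents_def)
    show ?thesis
      unfolding Q_def[abs_def] by measurable
  qed
  have Q1: "1 \<le> Q x" for x
    using q(1) q(2)[of x] enn2real_mono[of 1 "q x"] by (auto simp: Q_def exponents_def less_top)
  define c where "c = 2 * CARD('m) * (\<Prod>i\<in>UNIV. 2 * (a i * R powr \<kappa> i))"
  define D where "D t = ennreal (\<Phi> t / norm t ^ CARD('n)) * (\<Prod>i\<in>UNIV.
           ennreal (norm (A i t) powr \<kappa> i * c_const (A i t) (qs i) (\<alpha>s i)) *
           Lp_norm (r_exp (qs i) (A i t)) (\<lambda>_. 1))" for t
  have c: "0 < c"
    unfolding c_def using a R by (intro mult_pos_pos prod_pos) auto
  define K where "K z = norm (F z) * norm (fst z) powr \<alpha> * indicator (ball 0 R) (fst z)" for z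
  have [measurable]: "(\<lambda>x::real^'n. norm x powr b) \<in> borel_measurable lebesgue" for b
    by (intro measurable_completion) simp
  have [measurable]: "ball (0::real^'n) r \<in> sets lebesgue" for r
    by simp
  have pw [measurable]: "(\<lambda>z::(real^'n) \<times> (real^'n). norm (fst z) powr \<alpha>) \<in> borel_measurable (lebesgue \<Otimes>\<^sub>M lebesgue)"
    by (rule measurable_compose[OF measurable_fst]) measurable
  have K [measurable]: "K \<in> borel_measurable (lebesgue \<Otimes>\<^sub>M lebesgue)"
    unfolding K_def[abs_def] by measurable
  have K0: "0 \<le> K z" for z
    by (simp add: K_def)
  have "AE t in lebesgue. \<forall>\<eta>>0. ennreal c * D t \<le> ennreal \<eta> \<longrightarrow>
      (\<integral>\<^sup>+x. ennreal ((K (x, t) / \<eta>) powr Q x) \<partial>lebesgue) \<le> 1"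
    using inv le F2
  proof (eventually_elim, intro allI impI)
    fix t \<eta> assume inv: "\<Phi> t \<noteq> 0 \<longrightarrow> (\<forall>i. invertible (A i t))"
      and le: "\<Phi> t \<noteq> 0 \<longrightarrow> (\<forall>i. (\<forall>x. qs i (matrix_inv (A i t) *v x) \<le> qs i x) \<and> Lp_norm (r_exp (qs i) (A i t)) (\<lambda>_. 1) < \<infinity>)"
      and eq: "AE x in lebesgue. hausdorff_integrand \<Phi> A f x t = F (x, t)"
      and \<eta>: "0 < (\<eta>::real)" "ennreal c * D t \<le> ennreal \<eta>"
    let ?w = "\<Phi> t / norm t ^ CARD('n)"
    have w: "0 \<le> ?w"
      using \<Phi>0 by simp
    have "(\<integral>\<^sup>+x. ennreal ((K (x, t) / \<eta>) powr Q x) \<partial>lebesgue)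
      = (\<integral>\<^sup>+x. ennreal ((?w * (\<Prod>i\<in>UNIV. norm (f i (A i t *v x))) * norm x powr \<alpha> * indicator (ball 0 R) x / \<eta>) powr Q x) \<partial>lebesgue)"
    proof (rule nn_integral_cong_AE)
      show "AE x in lebesgue. ennreal ((K (x, t) / \<eta>) powr Q x) =
          ennreal ((?w * (\<Prod>i\<in>UNIV. norm (f i (A i t *v x))) * norm x powr \<alpha> * indicator (ball 0 R) x / \<eta>) powr Q x)"
        using eq
      proof eventually_elim
        case (elim x)
        have "norm (F (x, t)) = ?w * (\<Prod>i\<in>UNIV. norm (f i (A i t *v x)))"
          unfolding elim[symmetric] hausdorff_integrand_def using w by (simp only: norm_mult norm_of_real prod_norm abs_of_nonneg)
        then show ?case
          by (simp add: K_def)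
      qed
    qed
    also have "\<dots> \<le> 1"
    proof (cases "\<Phi> t = 0")
      case False
      show ?thesis
        unfolding \<alpha>_def
        by (rule kernel_modular_le[where qs = qs and a = a and \<kappa> = \<kappa> and Q = Q])
          (use False inv le \<eta> w a R bnd qs f Q1 Qm sum in \<open>auto simp: Q_def c_def D_def\<close>)
    qed simp
    finally show "(\<integral>\<^sup>+x. ennreal ((K (x, t) / \<eta>) powr Q x) \<partial>lebesgue) \<le> 1" .
  qed
  moreover have "(\<integral>\<^sup>+t. ennreal c * D t \<partial>lebesgue) < ennreal S"
    using nn_integral_cmult_le[OF c, of lebesgue D] S unfolding c_def D_def by (rule le_less_trans)
  ultimately have fin: "AE x in lebesgue. (\<integral>\<^sup>+t. ennreal (K (x, t)) \<partial>lebesgue) < \<infinity>"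
    and main: "(\<integral>\<^sup>+x. ennreal ((enn2real (\<integral>\<^sup>+t. ennreal (K (x, t)) \<partial>lebesgue) / S) powr Q x) \<partial>lebesgue) \<le> 1"
    using P.minkowski_modular[OF K K0 Qm Q1] by auto
  show "AE x in lebesgue. (\<integral>\<^sup>+t. ennreal (norm (F (x, t)) * norm x powr (\<Sum>i\<in>UNIV. \<alpha>s i) * indicator (ball 0 R) x) \<partial>lebesgue) < \<infinity>"
    using fin by (simp add: K_def \<alpha>_def)
  have S0: "0 < S"
    using le_less_trans[OF zero_le S] by simp
  let ?h = "\<lambda>x. hausdorff \<Phi> A f x * indicator (ball 0 R) x * of_real (norm x powr \<alpha>)"
  have "modular q (\<lambda>x. ?h x / of_real S) = (\<integral>\<^sup>+x. ennreal ((norm (?h x) / S) powr Q x) \<partial>lebesgue)"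
    using S0 by (simp add: modular_finite_exponent[OF q(2)] Q_def norm_divide)
  also have "\<dots> \<le> (\<integral>\<^sup>+x. ennreal ((enn2real (\<integral>\<^sup>+t. ennreal (K (x, t)) \<partial>lebesgue) / S) powr Q x) \<partial>lebesgue)"
  proof (rule nn_integral_mono_AE)
    show "AE x in lebesgue. ennreal ((norm (?h x) / S) powr Q x)
        \<le> ennreal ((enn2real (\<integral>\<^sup>+t. ennreal (K (x, t)) \<partial>lebesgue) / S) powr Q x)"
      using H
    proof eventually_elim
      case (elim x)
      have [measurable]: "(\<lambda>t. F (x, t)) \<in> borel_measurable lebesgue"
        by measurable
      have "norm (\<integral>t. F (x, t) \<partial>lebesgue) \<le> (\<integral>t. norm (F (x, t)) \<partial>lebesgue)"
        by (rule integral_norm_bound)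
      also have "\<dots> = enn2real (\<integral>\<^sup>+t. ennreal (norm (F (x, t))) \<partial>lebesgue)"
        by (rule integral_eq_nn_integral) auto
      finally have 1: "norm (hausdorff \<Phi> A f x) \<le> enn2real (\<integral>\<^sup>+t. ennreal (norm (F (x, t))) \<partial>lebesgue)"
        by (simp add: elim)
      define u where "u = norm x powr \<alpha> * indicator (ball 0 R) x"
      have u: "0 \<le> u" by (simp add: u_def)
      have "(\<integral>\<^sup>+t. ennreal (K (x, t)) \<partial>lebesgue) = (\<integral>\<^sup>+t. ennreal u * ennreal (norm (F (x, t))) \<partial>lebesgue)"
        using u by (intro nn_integral_cong) (simp add: K_def u_def mult_ac flip: ennreal_mult)
      also have "\<dots> = ennreal u * (\<integral>\<^sup>+t. ennreal (norm (F (x, t))) \<partial>lebesgue)"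
        by (rule nn_integral_cmult) measurable
      finally have "enn2real (\<integral>\<^sup>+t. ennreal (K (x, t)) \<partial>lebesgue) = u * enn2real (\<integral>\<^sup>+t. ennreal (norm (F (x, t))) \<partial>lebesgue)"
        using u by (simp add: enn2real_mult)
      moreover have "norm (?h x) = norm (hausdorff \<Phi> A f x) * u"
        by (simp add: norm_mult u_def indicator_def)
      ultimately have "norm (?h x) \<le> enn2real (\<integral>\<^sup>+t. ennreal (K (x, t)) \<partial>lebesgue)"
        using mult_right_mono[OF 1 u] by (simp add: mult.commute)
      then show ?case
        using S0 Q1[of x] by (intro ennreal_leI powr_mono2 divide_right_mono) auto
    qed
  qed
  also note main
  finally show "Lp_norm q (\<lambda>x. hausdorff \<Phi> A f x * indicator (ball 0 R) x * of_real (norm x powr (\<Sum>i\<in>UNIV. \<alpha>s i))) \<le> ennreal S"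
    unfolding Lp_norm_def \<alpha>_def[symmetric] using S0 by (intro INF_lower) auto
qed

section \<open>Boundedness on central Morrey spaces\<close>

text \<open>
  The strict inequality makes the modular at most \<open>1\<close> although the infimum in the Luxemburg
  norm might not be attained.
\<close>

lemma modular_le_one_of_morrey_norm_less:
  fixes f :: "'a::euclidean_space \<Rightarrow> complex"
  assumes fin: "\<And>x. q x \<noteq> \<infinity>" and less: "morrey_norm q lam \<omega> (\<lambda>x. norm x powr \<alpha>) f < ennreal a"
    and \<sigma>: "0 < \<sigma>" and weight: "\<And>R. 0 < R \<Longrightarrow> (LINT x:ball (0::'a) R|lebesgue. \<omega> x) = \<sigma> * R powr d"
    and \<rho>: "0 < \<rho>"
  shows "(\<integral>\<^sup>+y. ennreal ((norm (f y) * norm y powr \<alpha> * indicator (ball 0 \<rho>) y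
      / (a * \<sigma> powr (lam + rcp (q_infty q)) * \<rho> powr (d * (lam + rcp (q_infty q))))) powr enn2real (q y)) \<partial>lebesgue) \<le> 1"
proof -
  let ?\<theta> = "lam + rcp (q_infty q)"
  let ?g = "\<lambda>x. f x * indicator (ball 0 \<rho>) x * of_real (norm x powr \<alpha>)"
  define D where "D = \<sigma> powr ?\<theta> * \<rho> powr (d * ?\<theta>)"
  have D: "0 < D"
    using \<sigma> \<rho> by (simp add: D_def)
  have norm_ind: "norm (indicator (ball 0 \<rho>) x :: complex) = indicator (ball 0 \<rho>) x" for x :: 'a
    by (simp add: indicator_def)
  have eq: "(LINT x:ball (0::'a) \<rho>|lebesgue. \<omega> x) powr ?\<theta> = D"
    using \<sigma> \<rho> by (simp add: weight[OF \<rho>] D_def powr_mult powr_powr)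
  have "Lp_norm q ?g / ennreal D \<le> morrey_norm q lam \<omega> (\<lambda>x. norm x powr \<alpha>) f"
    unfolding morrey_norm_def weighted_Lp_norm_def eq[symmetric] using \<rho> by (intro SUP_upper) auto
  also note less
  finally have *: "Lp_norm q ?g / ennreal D < ennreal a" .
  have a: "0 < a"
    using le_less_trans[OF zero_le *] by simp
  have "Lp_norm q ?g < ennreal (a * D)"
  proof (rule ccontr)
    assume "\<not> Lp_norm q ?g < ennreal (a * D)"
    then have "ennreal (a * D) / ennreal D \<le> Lp_norm q ?g / ennreal D"
      by (intro divide_right_mono_ennreal) simp
    then have "ennreal a \<le> Lp_norm q ?g / ennreal D"
      using a D by (simp add: divide_ennreal)
    then show False
      using * by simp
  qed
  from modular_le_one_of_Lp_norm_less[OF fin this] show ?thesis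
    by (simp add: norm_mult norm_ind D_def mult_ac)
qed

text \<open>
  Norms that may vanish are replaced by strictly larger numbers, and the excess is removed in the limit.
\<close>

lemma le_prod_of_le_prod_add:
  fixes b :: "'i::finite \<Rightarrow> real" and Y :: ennreal
  assumes "\<And>\<epsilon>. 0 < \<epsilon> \<Longrightarrow> Y \<le> ennreal (C * (\<Prod>i\<in>UNIV. b i + \<epsilon>))"
  shows "Y \<le> ennreal (C * (\<Prod>i\<in>UNIV. b i))"
proof -
  have "((\<lambda>\<epsilon>. C * (\<Prod>i\<in>UNIV. b i + \<epsilon>)) \<longlongrightarrow> C * (\<Prod>i\<in>UNIV. b i + 0)) (at_right 0)"
    by (intro tendsto_intros)
  then have "((\<lambda>\<epsilon>. ennreal (C * (\<Prod>i\<in>UNIV. b i + \<epsilon>))) \<longlongrightarrow> ennreal (C * (\<Prod>i\<in>UNIV. b i))) (at_right 0)"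
    by simp
  moreover have "\<forall>\<^sub>F \<epsilon> in at_right 0. Y \<le> ennreal (C * (\<Prod>i\<in>UNIV. b i + \<epsilon>))"
    using assms by (auto simp: eventually_at_right_field intro!: exI[of _ 1])
  ultimately show ?thesis
    by (rule tendsto_lowerbound) simp
qed

theorem theorem3p10:
  fixes \<Phi> :: "real^'n \<Rightarrow> real"
    and A :: "'m::finite \<Rightarrow> real^'n \<Rightarrow> real^'n^'n"
    and q :: "real^'n \<Rightarrow> ennreal"
    and qs :: "'m \<Rightarrow> real^'n \<Rightarrow> ennreal"
    and lam \<alpha> \<gamma> :: real
    and lams \<alpha>s \<gamma>s :: "'m \<Rightarrow> real"
  assumes "\<Phi> \<in> borel_measurable lebesgue"
    and "\<And>t. 0 \<le> \<Phi> t"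
    and "\<And>i. A i \<in> borel_measurable lebesgue"
    and "AE t in lebesgue. t \<in> support_on UNIV \<Phi> \<longrightarrow> (\<forall>i. invertible (A i t))"
    and "\<And>i. qs i \<in> exponents_b \<inter> exponents_inf"
    and "q \<in> exponents_inf"
    and "\<And>i. - rcp (q_infty (qs i)) < lams i \<and> lams i < 0"
    and "\<And>i. - real CARD('n) < \<gamma>s i"
    and "\<And>x. (\<Sum>i\<in>UNIV. 1 / qs i x) = 1 / q x"
    and "(\<Sum>i\<in>UNIV. \<gamma>s i * rcp (q_infty (qs i))) = \<gamma> * rcp (q_infty q)"
    and "(\<Sum>i\<in>UNIV. (real CARD('n) + \<gamma>s i) / (real CARD('n) + \<gamma>) * lams i) = lam"
    and "(\<Sum>i\<in>UNIV. \<alpha>s i) = \<alpha>"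
    and "AE t in lebesgue. t \<in> support_on UNIV \<Phi> \<longrightarrow>
           (\<forall>i. (\<forall>x. qs i (matrix_inv (A i t) *v x) \<le> qs i x) \<and>
                Lp_norm (r_exp (qs i) (A i t)) (\<lambda>_. 1) < \<infinity>)"
    and "(\<integral>\<^sup>+t. ennreal (\<Phi> t / norm t ^ CARD('n)) *
            (\<Prod>i\<in>UNIV.
               ennreal (norm (A i t) powr ((real CARD('n) + \<gamma>s i) * (rcp (q_infty (qs i)) + lams i))
                        * c_const (A i t) (qs i) (\<alpha>s i))
               * Lp_norm (r_exp (qs i) (A i t)) (\<lambda>_. 1)) \<partial>lebesgue) < \<infinity>"
  shows "hausdorff_bounded \<Phi> A
           (\<lambda>i. morrey_space (qs i) (lams i) (\<lambda>x. norm x powr \<gamma>s i) (\<lambda>x. norm x powr \<alpha>s i))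
           (\<lambda>i. morrey_norm (qs i) (lams i) (\<lambda>x. norm x powr \<gamma>s i) (\<lambda>x. norm x powr \<alpha>s i))
           (morrey_norm q lam (\<lambda>x. norm x powr \<gamma>) (\<lambda>x. norm x powr \<alpha>))"
proof -
  have qs: "qs i \<in> exponents_b" "qs i \<in> exponents_inf" for i
    using assms(5)[of i] by auto
  have q: "q \<in> exponents"
    using assms(6) by (simp add: exponents_inf_def)
  note q_fin = sum_reciprocal_exponents(1)[OF qs(1) q assms(9)]
  note sum_Q = sum_reciprocal_exponents(2)[OF qs(1) q assms(9)]
  have inv: "AE t in lebesgue. \<Phi> t \<noteq> 0 \<longrightarrow> (\<forall>i. invertible (A i t))"
    using assms(4) by (simp add: support_on_def)
  have le: "AE t in lebesgue. \<Phi> t \<noteq> 0 \<longrightarrow>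
           (\<forall>i. (\<forall>x. qs i (matrix_inv (A i t) *v x) \<le> qs i x) \<and>
                Lp_norm (r_exp (qs i) (A i t)) (\<lambda>_. 1) < \<infinity>)"
    using assms(13) by (simp add: support_on_def)
  define n where "n = real CARD('n)"
  define \<theta> where "\<theta> i = lams i + rcp (q_infty (qs i))" for i
  define \<kappa> where "\<kappa> i = (n + \<gamma>s i) * \<theta> i" for i
  define \<theta>0 where "\<theta>0 = lam + rcp (q_infty q)"
  have "(\<Sum>i\<in>UNIV. (n + \<gamma>s i) * rcp (q_infty (qs i)))
      = n * (\<Sum>i\<in>UNIV. rcp (q_infty (qs i))) + (\<Sum>i\<in>UNIV. \<gamma>s i * rcp (q_infty (qs i)))"
    by (simp add: distrib_right sum.distrib sum_distrib_left)
  then have sum_rcp: "(\<Sum>i\<in>UNIV. (n + \<gamma>s i) * rcp (q_infty (qs i))) = (n + \<gamma>) * rcp (q_infty q)"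
    using sum_rcp_q_infty[OF qs(2) assms(6,9)] assms(10) by (simp add: distrib_right)
  have "0 < (\<Sum>i\<in>UNIV. (n + \<gamma>s i) * rcp (q_infty (qs i)))"
  proof (intro sum_pos mult_pos_pos)
    show "0 < n + \<gamma>s i" for i
      using assms(8)[of i] by (simp add: n_def)
  qed (auto intro: rcp_q_infty_pos qs)
  \<comment> \<open>needed since the relation for \<open>\<lambda>\<close> divides by \<open>n + \<gamma>\<close>, and division by zero yields zero\<close>
  then have n\<gamma>: "0 < n + \<gamma>"
    unfolding sum_rcp using enn2real_nonneg[of "1 / q_infty q"]
    by (auto simp: rcp_def zero_less_mult_iff)
  have "(n + \<gamma>) * lam = (\<Sum>i\<in>UNIV. (n + \<gamma>s i) * lams i)"
    unfolding assms(11)[symmetric] n_def[symmetric] sum_distrib_left using n\<gamma> by simp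
  \<comment> \<open>the powers of \<open>R\<close> from the source norms match the one in the target norm\<close>
  then have sum_\<kappa>: "(\<Sum>i\<in>UNIV. \<kappa> i) = (n + \<gamma>) * \<theta>0"
    using sum_rcp by (simp add: \<kappa>_def \<theta>_def \<theta>0_def distrib_left sum.distrib)
  have weight: "\<exists>\<sigma>. 0 < \<sigma> \<and> (\<forall>R>0. (LINT x:ball (0::real^'n) R|lebesgue. norm x powr g) = \<sigma> * R powr (n + g))"
    if "0 < n + g" for g
    using LINT_norm_powr_ball[where 'a = "real^'n", of g] that by (auto simp: n_def)
  have "\<exists>\<sigma>. \<forall>i. 0 < \<sigma> i \<and> (\<forall>R>0. (LINT x:ball (0::real^'n) R|lebesgue. norm x powr \<gamma>s i) = \<sigma> i * R powr (n + \<gamma>s i))"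
  proof (intro choice allI weight)
    show "0 < n + \<gamma>s i" for i
      using assms(8)[of i] by (simp add: n_def)
  qed
  then obtain \<sigma> where \<sigma>: "\<And>i. 0 < \<sigma> i"
      "\<And>i R. 0 < R \<Longrightarrow> (LINT x:ball (0::real^'n) R|lebesgue. norm x powr \<gamma>s i) = \<sigma> i * R powr (n + \<gamma>s i)"
    by blast
  obtain \<sigma>0 where \<sigma>0: "0 < \<sigma>0"
      "\<And>R. 0 < R \<Longrightarrow> (LINT x:ball (0::real^'n) R|lebesgue. norm x powr \<gamma>) = \<sigma>0 * R powr (n + \<gamma>)"
    using weight[OF n\<gamma>] by blast
  define I where "I = (\<integral>\<^sup>+t. ennreal (\<Phi> t / norm t ^ CARD('n)) * (\<Prod>i\<in>UNIV.
           ennreal (norm (A i t) powr \<kappa> i * c_const (A i t) (qs i) (\<alpha>s i)) *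
           Lp_norm (r_exp (qs i) (A i t)) (\<lambda>_. 1)) \<partial>lebesgue)"
  define c where "c = enn2real I"
  have "I < \<infinity>"
    using assms(14) unfolding I_def \<kappa>_def \<theta>_def n_def by (simp add: add.commute)
  then have I: "I = ennreal c" "0 \<le> c"
    by (simp_all add: c_def)
  define s where "s i = \<sigma> i powr \<theta> i" for i
  define s0 where "s0 = \<sigma>0 powr \<theta>0"
  have s: "0 < s i" "0 < s0" for i
    using \<sigma>(1)[of i] \<sigma>0(1) by (simp_all add: s_def s0_def)
  define C where "C = 2 * CARD('m) * (\<Prod>i\<in>UNIV. 2 * s i) * c / s0"
  have C: "0 \<le> C"
    unfolding C_def using s I by (intro divide_nonneg_nonneg mult_nonneg_nonneg prod_nonneg) (auto simp: less_imp_le)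
  show ?thesis
    unfolding hausdorff_bounded_def
  proof (intro exI[of _ C] conjI C allI impI)
    fix f :: "'m \<Rightarrow> real^'n \<Rightarrow> complex"
    let ?X = "\<lambda>i. morrey_space (qs i) (lams i) (\<lambda>x. norm x powr \<gamma>s i) (\<lambda>x. norm x powr \<alpha>s i)"
    let ?N = "\<lambda>i. morrey_norm (qs i) (lams i) (\<lambda>x. norm x powr \<gamma>s i) (\<lambda>x. norm x powr \<alpha>s i) (f i)"
    assume "\<forall>i. f i \<in> ?X i"
    then have f: "f i \<in> borel_measurable lebesgue" and fN: "?N i < \<infinity>" for i
      by (auto simp: morrey_space_def locally_integrable_def)
    define b where "b i = enn2real (?N i)" for i
    have b: "?N i = ennreal (b i)" "0 \<le> b i" for i
      using fN[of i] by (simp_all add: b_def)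
    interpret L: sigma_finite_measure "lebesgue :: (real^'n) measure"
      by (rule sigma_finite_lebesgue)
    obtain F where F [measurable]: "F \<in> borel_measurable (lebesgue \<Otimes>\<^sub>M lebesgue)"
      and F1: "AE x in lebesgue. AE t in lebesgue. hausdorff_integrand \<Phi> A f x t = F (x, t)"
      and F2: "AE t in lebesgue. AE x in lebesgue. hausdorff_integrand \<Phi> A f x t = F (x, t)"
      by (rule hausdorff_integrand_representative[OF assms(1,3) inv f])
    have F_sec [measurable]: "(\<lambda>t. F (x, t)) \<in> borel_measurable lebesgue" for x
      by measurable
    have H: "AE x in lebesgue. hausdorff \<Phi> A f x = (\<integral>t. F (x, t) \<partial>lebesgue)"
      using F1
    proof eventually_elim
      case (elim x)
      then show ?case
        unfolding hausdorff_def
        by (intro integral_cong_AE borel_measurable_lebesgue_cong_AE[OF F_sec elim] F_sec)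
    qed
    have bnd: "(\<integral>\<^sup>+y. ennreal ((norm (f i y) * norm y powr \<alpha>s i * indicator (ball 0 \<rho>) y
                 / ((b i + \<epsilon>) * s i * \<rho> powr \<kappa> i)) powr enn2real (qs i y)) \<partial>lebesgue) \<le> 1"
      if "0 < \<epsilon>" "0 < \<rho>" for i \<epsilon> \<rho>
    proof -
      have less: "?N i < ennreal (b i + \<epsilon>)"
        using b[of i] that by (simp add: ennreal_less_iff)
      show ?thesis
        using modular_le_one_of_morrey_norm_less[OF exponents_b_finite[OF qs(1)] less \<sigma>(1) \<sigma>(2) that(2)]
        by (simp add: s_def \<theta>_def \<kappa>_def)
    qed
    have apos: "0 < (b i + \<epsilon>) * s i" if "0 < \<epsilon>" for i \<epsilon>
      using b(2)[of i] s(1)[of i] that by (simp add: add_nonneg_pos)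
    define cR where "cR \<epsilon> R = 2 * CARD('m) * (\<Prod>i\<in>UNIV. 2 * (((b i + \<epsilon>) * s i) * R powr \<kappa> i))" for \<epsilon> R
    have cR0: "0 \<le> cR \<epsilon> R" if "0 < \<epsilon>" for \<epsilon> R
      unfolding cR_def using b(2) s(1) that
      by (intro mult_nonneg_nonneg prod_nonneg) (auto simp: less_imp_le add_nonneg_nonneg)
    have ball: "(AE x in lebesgue. (\<integral>\<^sup>+t. ennreal (norm (F (x, t)) * norm x powr (\<Sum>i\<in>UNIV. \<alpha>s i) * indicator (ball 0 R) x) \<partial>lebesgue) < \<infinity>)
        \<and> Lp_norm q (\<lambda>x. hausdorff \<Phi> A f x * indicator (ball 0 R) x * of_real (norm x powr (\<Sum>i\<in>UNIV. \<alpha>s i))) \<le> ennreal S"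
      if "0 < \<epsilon>" "0 < R" "cR \<epsilon> R * c < S" for \<epsilon> R S
    proof -
      have "ennreal (cR \<epsilon> R) * I < ennreal S"
        using that I cR0[OF that(1), of R] by (simp add: ennreal_less_iff flip: ennreal_mult)
      then show ?thesis
        unfolding cR_def I_def
        using hausdorff_Lp_norm_ball_le[OF assms(2) inv f F F1 F2 H qs(1) q q_fin sum_Q le apos[OF that(1)] bnd[OF that(1)] that(2)]
        by blast
    qed
    \<comment> \<open>balls of integer radius exhaust the space, and the weight is positive off the origin\<close>
    show "AE x in lebesgue. integrable lebesgue (hausdorff_integrand \<Phi> A f x)"
    proof -
      have "AE x in lebesgue. \<forall>k::nat. (\<integral>\<^sup>+t. ennreal (norm (F (x, t)) * norm x powr (\<Sum>i\<in>UNIV. \<alpha>s i) * indicator (ball 0 (real k + 1)) x) \<partial>lebesgue) < \<infinity>"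
        unfolding AE_all_countable using ball[of 1 "real k + 1" "cR 1 (real k + 1) * c + 1" for k] by auto
      moreover have "AE x in lebesgue. x \<noteq> (0::real^'n)"
        using AE_lborel_singleton by (rule AE_completion)
      ultimately show ?thesis
        using F1
      proof eventually_elim
        case (elim x)
        obtain k :: nat where "norm x < real k"
          using reals_Archimedean2 by blast
        then have x: "x \<in> ball 0 (real k + 1)"
          by simp
        define u where "u = norm x powr (\<Sum>i\<in>UNIV. \<alpha>s i)"
        have u: "0 < u"
          using elim by (simp add: u_def)
        have "(\<integral>\<^sup>+t. ennreal (norm (F (x, t)) * norm x powr (\<Sum>i\<in>UNIV. \<alpha>s i) * indicator (ball 0 (real k + 1)) x) \<partial>lebesgue)
            = (\<integral>\<^sup>+t. ennreal u * ennreal (norm (F (x, t))) \<partial>lebesgue)"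
          using u x by (intro nn_integral_cong) (simp add: u_def mult.commute flip: ennreal_mult)
        also have "\<dots> = ennreal u * (\<integral>\<^sup>+t. ennreal (norm (F (x, t))) \<partial>lebesgue)"
          by (rule nn_integral_cmult) measurable
        finally have "ennreal u * (\<integral>\<^sup>+t. ennreal (norm (F (x, t))) \<partial>lebesgue) < \<infinity>"
          using elim(1) by metis
        then have "(\<integral>\<^sup>+t. ennreal (norm (F (x, t))) \<partial>lebesgue) < \<infinity>"
          using u by (auto simp: ennreal_mult_less_top)
        then have "integrable lebesgue (\<lambda>t. F (x, t))"
          by (intro integrableI_bounded) auto
        then show ?case
          using integrable_cong_AE[OF borel_measurable_lebesgue_cong_AE[OF F_sec elim(3)] F_sec elim(3)] by blast
      qed
    qed
    show "hausdorff \<Phi> A f \<in> borel_measurable lebesgue"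
    proof (rule borel_measurable_lebesgue_cong_AE[OF _ H])
      have "(\<lambda>(x, t). F (x, t)) \<in> borel_measurable (lebesgue \<Otimes>\<^sub>M lebesgue)"
        by simp
      then show "(\<lambda>x. \<integral>t. F (x, t) \<partial>lebesgue) \<in> borel_measurable lebesgue"
        by (rule L.borel_measurable_lebesgue_integral)
    qed
    have "morrey_norm q lam (\<lambda>x. norm x powr \<gamma>) (\<lambda>x. norm x powr \<alpha>) (hausdorff \<Phi> A f)
        \<le> ennreal (C * (\<Prod>i\<in>UNIV. b i))"
    proof (rule le_prod_of_le_prod_add)
      fix \<epsilon> :: real assume \<epsilon>: "0 < \<epsilon>"
      show "morrey_norm q lam (\<lambda>x. norm x powr \<gamma>) (\<lambda>x. norm x powr \<alpha>) (hausdorff \<Phi> A f)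
          \<le> ennreal (C * (\<Prod>i\<in>UNIV. b i + \<epsilon>))"
        unfolding morrey_norm_def
      proof (rule SUP_least)
        fix R :: real assume "R \<in> {0<..}"
        then have R: "0 < R" by simp
        let ?L = "weighted_Lp_norm q (\<lambda>x. norm x powr \<alpha>) (\<lambda>x. hausdorff \<Phi> A f x * indicator (ball 0 R) x)"
        define D where "D = s0 * R powr ((n + \<gamma>) * \<theta>0)"
        have D: "0 < D"
          using s R by (simp add: D_def)
        have "(LINT x:ball (0::real^'n) R|lebesgue. norm x powr \<gamma>) powr (lam + rcp (q_infty q)) = D"
          unfolding \<sigma>0(2)[OF R] D_def s0_def \<theta>0_def[symmetric]
          using R \<sigma>0(1) by (simp add: powr_mult powr_powr)
        moreover have "?L \<le> ennreal (cR \<epsilon> R * c)"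
        proof (rule ennreal_le_epsilon)
          fix e :: real assume e: "0 < e"
          have "0 \<le> cR \<epsilon> R * c"
            using cR0[OF \<epsilon>] I(2) by simp
          then show "?L \<le> ennreal (cR \<epsilon> R * c) + ennreal e"
            using ball[OF \<epsilon> R, of "cR \<epsilon> R * c + e"] e assms(12)
            by (simp add: weighted_Lp_norm_def)
        qed
        then have "?L / ennreal D \<le> ennreal (cR \<epsilon> R * c) / ennreal D"
          by (rule divide_right_mono_ennreal)
        moreover have "cR \<epsilon> R * c = C * (\<Prod>i\<in>UNIV. b i + \<epsilon>) * D"
        proof -
          have "(\<Prod>i\<in>UNIV. R powr \<kappa> i) = R powr ((n + \<gamma>) * \<theta>0)"
            using R powr_sum[of R \<kappa> UNIV] by (simp add: sum_\<kappa>)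
          then have "cR \<epsilon> R = 2 * CARD('m) * (\<Prod>i\<in>UNIV. 2 * s i) * (\<Prod>i\<in>UNIV. b i + \<epsilon>) * R powr ((n + \<gamma>) * \<theta>0)"
            by (simp add: cR_def prod.distrib mult_ac)
          then show ?thesis
            using s(2) by (simp add: C_def D_def field_simps)
        qed
        moreover have "0 \<le> C * (\<Prod>i\<in>UNIV. b i + \<epsilon>)"
          using C b(2) \<epsilon> by (intro mult_nonneg_nonneg prod_nonneg) (auto simp: add_nonneg_nonneg less_imp_le)
        ultimately show "?L / ennreal ((LINT x:ball (0::real^'n) R|lebesgue. norm x powr \<gamma>) powr (lam + rcp (q_infty q)))
            \<le> ennreal (C * (\<Prod>i\<in>UNIV. b i + \<epsilon>))"
          using D by (simp add: divide_ennreal)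
      qed
    qed
    also have "\<dots> = ennreal C * (\<Prod>i\<in>UNIV. ?N i)"
      using C b by (simp add: ennreal_mult prod_nonneg prod_ennreal)
    finally show "morrey_norm q lam (\<lambda>x. norm x powr \<gamma>) (\<lambda>x. norm x powr \<alpha>) (hausdorff \<Phi> A f)
        \<le> ennreal C * (\<Prod>i\<in>UNIV. ?N i)" .
  qed
qed

end
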